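(* In the theory of Heyting algebras, the equations $x\sqcup\neg x=\top$ and $\neg\neg x=x$ have dimensional gap. That is, for $\varphi(x)$ either of these two equations and for every infinite definable Heyting algebra $H$, either $\dim\{x\in H : \varphi(x)\}<\dim H$ or $\{x\in H : \varphi(x)\}=H$.
   Context: Fix an o-minimal structure $R$ expanding a real-closed field. "Definable" means definable in $R$ with parameters; $\dim$ is o-minimal dimension. A Heyting algebra is a bounded distributive lattice $(H,\sqsubseteq)$ in which for all $x,y\in H$ the set $\{z\in H : x\sqcap z\sqsubseteq y\}$ has a maximum element, denoted $x\Rightarrow y$; $\neg x$ abbreviates $x\Rightarrow\bot$. It is definable if $H$ is a definable subset of some $R^n$ and $\sqsubseteq$ is a definable relation. Dimensional gap: for a first-order language $\mathcal L$ and an $\mathcal L$-theory $T$, an $\mathcal L$-formula $\varphi(x_1,\dots,x_n)$ has dimensional gap if in every infinite definable $\mathcal L$-structure $M\models T$ either $\dim M^n>\dim\{\bar x\in M^n : \varphi(\bar x)\}$ or $M^n=\{\bar x\in M^n : \varphi(\bar x)\}$. *)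

theory Defs
  imports
    "HOL-Computational_Algebra.Polynomial"
    "HOL-Library.Extended_Real"
    "HOL-Algebra.Lattice"
begin

section \<open>First-order languages, structures and formulas\<close>

text \<open>The symbols of a language are the \<^term>\<open>f\<close> and \<^term>\<open>p\<close> for which the arity is defined,
  so that either kind of symbol may be absent although types are nonempty.\<close>

record ('f, 'p) fo_lang =
  fun_arity :: "'f \<Rightarrow> nat option"
  rel_arity :: "'p \<Rightarrow> nat option"

datatype 'f fo_term = Var nat | App 'f "'f fo_term list"

datatype ('f, 'p) fo_formula =
    Eq "'f fo_term" "'f fo_term"
  | Rel 'p "'f fo_term list"
  | Neg "('f, 'p) fo_formula"
  | Conj "('f, 'p) fo_formula" "('f, 'p) fo_formula"
  | Exists nat "('f, 'p) fo_formula"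

abbreviation Impl :: "('f, 'p) fo_formula \<Rightarrow> ('f, 'p) fo_formula \<Rightarrow> ('f, 'p) fo_formula" where
  "Impl \<phi> \<psi> \<equiv> Neg (Conj \<phi> (Neg \<psi>))"

abbreviation Forall :: "nat \<Rightarrow> ('f, 'p) fo_formula \<Rightarrow> ('f, 'p) fo_formula" where
  "Forall x \<phi> \<equiv> Neg (Exists x (Neg \<phi>))"

primrec term_vars :: "'f fo_term \<Rightarrow> nat set" where
  "term_vars (Var x) = {x}"
| "term_vars (App f ts) = \<Union> (set (map term_vars ts))"

primrec free_vars :: "('f, 'p) fo_formula \<Rightarrow> nat set" where
  "free_vars (Eq s t) = term_vars s \<union> term_vars t"
| "free_vars (Rel p ts) = \<Union> (set (map term_vars ts))"
| "free_vars (Neg \<phi>) = free_vars \<phi>"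
| "free_vars (Conj \<phi> \<psi>) = free_vars \<phi> \<union> free_vars \<psi>"
| "free_vars (Exists x \<phi>) = free_vars \<phi> - {x}"

primrec wf_term :: "('f, 'p) fo_lang \<Rightarrow> 'f fo_term \<Rightarrow> bool" where
  "wf_term L (Var x) \<longleftrightarrow> True"
| "wf_term L (App f ts) \<longleftrightarrow> fun_arity L f = Some (length ts) \<and> list_all id (map (wf_term L) ts)"

primrec wf_formula :: "('f, 'p) fo_lang \<Rightarrow> ('f, 'p) fo_formula \<Rightarrow> bool" where
  "wf_formula L (Eq s t) \<longleftrightarrow> wf_term L s \<and> wf_term L t"
| "wf_formula L (Rel p ts) \<longleftrightarrow> rel_arity L p = Some (length ts) \<and> list_all (wf_term L) ts"
| "wf_formula L (Neg \<phi>) \<longleftrightarrow> wf_formula L \<phi>"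
| "wf_formula L (Conj \<phi> \<psi>) \<longleftrightarrow> wf_formula L \<phi> \<and> wf_formula L \<psi>"
| "wf_formula L (Exists x \<phi>) \<longleftrightarrow> wf_formula L \<phi>"

record ('f, 'p, 'u) fo_struct =
  univ :: "'u set"
  fun_int :: "'f \<Rightarrow> 'u list \<Rightarrow> 'u"
  rel_int :: "'p \<Rightarrow> 'u list \<Rightarrow> bool"

definition tuples :: "nat \<Rightarrow> 'u set \<Rightarrow> 'u list set" where
  "tuples n U = {xs. length xs = n \<and> set xs \<subseteq> U}"

definition is_structure :: "('f, 'p) fo_lang \<Rightarrow> ('f, 'p, 'u) fo_struct \<Rightarrow> bool" where
  "is_structure L M \<longleftrightarrow> univ M \<noteq> {} \<and>
     (\<forall>f n. fun_arity L f = Some n \<longrightarrow> (\<forall>xs\<in>tuples n (univ M). fun_int M f xs \<in> univ M))"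

primrec eval_term :: "('f, 'p, 'u) fo_struct \<Rightarrow> (nat \<Rightarrow> 'u) \<Rightarrow> 'f fo_term \<Rightarrow> 'u" where
  "eval_term M e (Var x) = e x"
| "eval_term M e (App f ts) = fun_int M f (map (eval_term M e) ts)"

primrec sat :: "('f, 'p, 'u) fo_struct \<Rightarrow> (nat \<Rightarrow> 'u) \<Rightarrow> ('f, 'p) fo_formula \<Rightarrow> bool" where
  "sat M e (Eq s t) \<longleftrightarrow> eval_term M e s = eval_term M e t"
| "sat M e (Rel p ts) \<longleftrightarrow> rel_int M p (map (eval_term M e) ts)"
| "sat M e (Neg \<phi>) \<longleftrightarrow> \<not> sat M e \<phi>"
| "sat M e (Conj \<phi> \<psi>) \<longleftrightarrow> sat M e \<phi> \<and> sat M e \<psi>"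
| "sat M e (Exists x \<phi>) \<longleftrightarrow> (\<exists>a\<in>univ M. sat M (e(x := a)) \<phi>)"

text \<open>A formula \<open>\<phi>(x\<^sub>1, \<dots>, x\<^sub>n)\<close>; the variables are numbered from \<open>0\<close> to \<open>n - 1\<close>.\<close>

definition formula_in :: "('f, 'p) fo_lang \<Rightarrow> nat \<Rightarrow> ('f, 'p) fo_formula \<Rightarrow> bool" where
  "formula_in L n \<phi> \<longleftrightarrow> wf_formula L \<phi> \<and> free_vars \<phi> \<subseteq> {..<n}"

definition solutions :: "('f, 'p, 'u) fo_struct \<Rightarrow> nat \<Rightarrow> ('f, 'p) fo_formula \<Rightarrow> 'u list set" where
  "solutions M n \<phi> = {xs \<in> tuples n (univ M). sat M (\<lambda>i. xs ! i) \<phi>}"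

definition models :: "('f, 'p, 'u) fo_struct \<Rightarrow> ('f, 'p) fo_formula set \<Rightarrow> bool" where
  "models M T \<longleftrightarrow> (\<forall>\<phi>\<in>T. \<forall>e. range e \<subseteq> univ M \<longrightarrow> sat M e \<phi>)"


section \<open>O-minimal structures expanding a real-closed field\<close>

class real_closed_field = linordered_field +
  assumes ex_square_root: "0 \<le> a \<Longrightarrow> \<exists>b. a = b * b"
    and odd_degree_root:
      "odd n \<Longrightarrow> c n \<noteq> 0 \<Longrightarrow> \<exists>x. (\<Sum>i\<le>n. c i * x ^ i) = 0"

text \<open>Points of \<open>R\<^sup>n\<close> are lists of length \<open>n\<close>. The variables from \<open>n\<close> on are the parameters;
  their values are given by \<open>e\<close>.\<close>

definition definable ::
    "('f, 'p) fo_lang \<Rightarrow> ('f, 'p, 'a) fo_struct \<Rightarrow> nat \<Rightarrow> 'a list set \<Rightarrow> bool" where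
  "definable L R n X \<longleftrightarrow>
     (\<exists>\<phi> e. wf_formula L \<phi> \<and> range e \<subseteq> univ R \<and>
        X = {xs \<in> tuples n (univ R). sat R (\<lambda>i. if i < n then xs ! i else e i) \<phi>})"

definition open_interval :: "'a::linorder set \<Rightarrow> bool" where
  "open_interval I \<longleftrightarrow>
     I = UNIV \<or> (\<exists>a. I = {a<..}) \<or> (\<exists>b. I = {..<b}) \<or> (\<exists>a b. I = {a<..<b})"

locale o_minimal_field =
  fixes L :: "('f, 'p) fo_lang"
    and R :: "('f, 'p, 'a::real_closed_field) fo_struct"
  assumes univ_R: "univ R = UNIV"
    and zero_symbol: "\<exists>f. fun_arity L f = Some 0 \<and> fun_int R f [] = 0"
    and one_symbol: "\<exists>f. fun_arity L f = Some 0 \<and> fun_int R f [] = 1"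
    and minus_symbol: "\<exists>f. fun_arity L f = Some 1 \<and> (\<forall>x. fun_int R f [x] = - x)"
    and plus_symbol: "\<exists>f. fun_arity L f = Some 2 \<and> (\<forall>x y. fun_int R f [x, y] = x + y)"
    and times_symbol: "\<exists>f. fun_arity L f = Some 2 \<and> (\<forall>x y. fun_int R f [x, y] = x * y)"
    and less_symbol: "\<exists>p. rel_arity L p = Some 2 \<and> (\<forall>x y. rel_int R p [x, y] \<longleftrightarrow> x < y)"
    and o_minimal: "definable L R 1 X \<Longrightarrow>
      \<exists>F. finite F \<and> (\<forall>I\<in>F. open_interval I \<or> (\<exists>a. I = {a})) \<and> {x. [x] \<in> X} = \<Union> F"


section \<open>Cells and dimension\<close>

text \<open>Continuity on \<open>C \<subseteq> R\<^sup>n\<close> for the order topology of \<open>R\<close> and the product topology of \<open>R\<^sup>n\<close>.\<close>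

definition cont_on :: "'a::linordered_field list set \<Rightarrow> ('a list \<Rightarrow> 'a) \<Rightarrow> bool" where
  "cont_on C f \<longleftrightarrow>
     (\<forall>xs\<in>C. \<forall>\<epsilon>>0. \<exists>\<delta>>0. \<forall>ys\<in>C.
        (\<forall>i<length xs. \<bar>ys ! i - xs ! i\<bar> < \<delta>) \<longrightarrow> \<bar>f ys - f xs\<bar> < \<epsilon>)"

definition definable_cont :: "('f, 'p) fo_lang \<Rightarrow> ('f, 'p, 'a::linordered_field) fo_struct \<Rightarrow> nat \<Rightarrow>
    'a list set \<Rightarrow> ('a list \<Rightarrow> 'a) \<Rightarrow> bool" where
  "definable_cont L R n C f \<longleftrightarrow>
     definable L R (Suc n) {xs @ [f xs] |xs. xs \<in> C} \<and> cont_on C f"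

text \<open>\<open>cell L R n d C\<close> means that \<open>C\<close> is an \<open>(i\<^sub>1, \<dots>, i\<^sub>n)\<close>-cell in \<open>R\<^sup>n\<close> for some
  \<open>i\<^sub>1, \<dots>, i\<^sub>n \<in> {0, 1}\<close> with sum \<open>d\<close>. The bounds \<open>l\<close> and \<open>u\<close> of a band are functions, or \<open>None\<close>
  for the constant functions \<open>-\<infinity>\<close> and \<open>+\<infinity>\<close>.\<close>

inductive cell :: "('f, 'p) fo_lang \<Rightarrow> ('f, 'p, 'a::linordered_field) fo_struct \<Rightarrow> nat \<Rightarrow> nat \<Rightarrow>
    'a list set \<Rightarrow> bool"
  for L R where
  point: "cell L R 0 0 {[]}"
| graph: "cell L R n d C \<Longrightarrow> definable_cont L R n C f \<Longrightarrow>
    cell L R (Suc n) d {xs @ [f xs] |xs. xs \<in> C}"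
| band: "cell L R n d C \<Longrightarrow>
    (\<And>f. l = Some f \<Longrightarrow> definable_cont L R n C f) \<Longrightarrow>
    (\<And>g. u = Some g \<Longrightarrow> definable_cont L R n C g) \<Longrightarrow>
    (\<And>f g xs. l = Some f \<Longrightarrow> u = Some g \<Longrightarrow> xs \<in> C \<Longrightarrow> f xs < g xs) \<Longrightarrow>
    cell L R (Suc n) (Suc d)
      {xs @ [y] |xs y. xs \<in> C \<and> (\<forall>f. l = Some f \<longrightarrow> f xs < y) \<and> (\<forall>g. u = Some g \<longrightarrow> y < g xs)}"

text \<open>The empty set has dimension \<open>-\<infinity>\<close>.\<close>

definition o_dim :: "('f, 'p) fo_lang \<Rightarrow> ('f, 'p, 'a::linordered_field) fo_struct \<Rightarrow> nat \<Rightarrow>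
    'a list set \<Rightarrow> ereal" where
  "o_dim L R n X = Sup {ereal (real d) |d. \<exists>C. cell L R n d C \<and> C \<subseteq> X}"


section \<open>Definable structures and dimensional gap\<close>

text \<open>A structure \<open>M\<close> for a language \<open>L'\<close> with universe in \<open>R\<^sup>k\<close>. A tuple of \<open>n\<close> points of \<open>R\<^sup>k\<close> is
  identified with a point of \<open>R\<^sup>n\<^sup>k\<close> by concatenation.\<close>

definition definable_structure ::
    "('f, 'p) fo_lang \<Rightarrow> ('f, 'p, 'a) fo_struct \<Rightarrow> ('g, 'q) fo_lang \<Rightarrow> nat \<Rightarrow>
     ('g, 'q, 'a list) fo_struct \<Rightarrow> bool" where
  "definable_structure L R L' k M \<longleftrightarrow>
     is_structure L' M \<and> definable L R k (univ M) \<and>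
     (\<forall>g n. fun_arity L' g = Some n \<longrightarrow>
        definable L R ((n + 1) * k) {concat (xs @ [fun_int M g xs]) |xs. xs \<in> tuples n (univ M)}) \<and>
     (\<forall>q n. rel_arity L' q = Some n \<longrightarrow>
        definable L R (n * k) {concat xs |xs. xs \<in> tuples n (univ M) \<and> rel_int M q xs})"

definition dimensional_gap ::
    "('f, 'p) fo_lang \<Rightarrow> ('f, 'p, 'a::linordered_field) fo_struct \<Rightarrow> ('g, 'q) fo_lang \<Rightarrow>
     ('g, 'q) fo_formula set \<Rightarrow> nat \<Rightarrow> ('g, 'q) fo_formula \<Rightarrow> bool" where
  "dimensional_gap L R L' T n \<phi> \<longleftrightarrow>
     (\<forall>\<psi>\<in>T. formula_in L' 0 \<psi>) \<and> formula_in L' n \<phi> \<and>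
     (\<forall>k M. definable_structure L R L' k M \<and> infinite (univ M) \<and> models M T \<longrightarrow>
        o_dim L R (n * k) (concat ` tuples n (univ M)) > o_dim L R (n * k) (concat ` solutions M n \<phi>) \<or>
        tuples n (univ M) = solutions M n \<phi>)"


section \<open>The theory of Heyting algebras\<close>

datatype heyting_fun = HBot | HTop | HMeet | HJoin | HImp
datatype heyting_rel = HLe

definition heyting_lang :: "(heyting_fun, heyting_rel) fo_lang" where
  "heyting_lang = \<lparr>
     fun_arity = (\<lambda>f. Some (case f of HBot \<Rightarrow> 0 | HTop \<Rightarrow> 0 | HMeet \<Rightarrow> 2 | HJoin \<Rightarrow> 2 | HImp \<Rightarrow> 2)),
     rel_arity = (\<lambda>_. Some 2)\<rparr>"

abbreviation bot_tm :: "heyting_fun fo_term" where "bot_tm \<equiv> App HBot []"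
abbreviation top_tm :: "heyting_fun fo_term" where "top_tm \<equiv> App HTop []"
abbreviation meet_tm :: "heyting_fun fo_term \<Rightarrow> heyting_fun fo_term \<Rightarrow> heyting_fun fo_term" where
  "meet_tm s t \<equiv> App HMeet [s, t]"
abbreviation join_tm :: "heyting_fun fo_term \<Rightarrow> heyting_fun fo_term \<Rightarrow> heyting_fun fo_term" where
  "join_tm s t \<equiv> App HJoin [s, t]"
abbreviation imp_tm :: "heyting_fun fo_term \<Rightarrow> heyting_fun fo_term \<Rightarrow> heyting_fun fo_term" where
  "imp_tm s t \<equiv> App HImp [s, t]"
abbreviation neg_tm :: "heyting_fun fo_term \<Rightarrow> heyting_fun fo_term" where
  "neg_tm s \<equiv> imp_tm s bot_tm"
abbreviation le_fm ::
    "heyting_fun fo_term \<Rightarrow> heyting_fun fo_term \<Rightarrow> (heyting_fun, heyting_rel) fo_formula" where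
  "le_fm s t \<equiv> Rel HLe [s, t]"

definition heyting_theory :: "(heyting_fun, heyting_rel) fo_formula set" where
  "heyting_theory =
    (let x = Var 0; y = Var 1; z = Var 2;
         all1 = Forall 0; all2 = (\<lambda>\<phi>. Forall 0 (Forall 1 \<phi>));
         all3 = (\<lambda>\<phi>. Forall 0 (Forall 1 (Forall 2 \<phi>)))
     in { all1 (le_fm x x),
          all2 (Impl (Conj (le_fm x y) (le_fm y x)) (Eq x y)),
          all3 (Impl (Conj (le_fm x y) (le_fm y z)) (le_fm x z)),
          all1 (le_fm bot_tm x),
          all1 (le_fm x top_tm),
          all2 (Conj (le_fm (meet_tm x y) x) (le_fm (meet_tm x y) y)),
          all3 (Impl (Conj (le_fm z x) (le_fm z y)) (le_fm z (meet_tm x y))),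
          all2 (Conj (le_fm x (join_tm x y)) (le_fm y (join_tm x y))),
          all3 (Impl (Conj (le_fm x z) (le_fm y z)) (le_fm (join_tm x y) z)),
          all3 (Eq (meet_tm x (join_tm y z)) (join_tm (meet_tm x y) (meet_tm x z))),
          all2 (le_fm (meet_tm x (imp_tm x y)) y),
          all3 (Impl (le_fm (meet_tm x z) y) (le_fm z (imp_tm x y))) })"

definition excluded_middle_eq :: "(heyting_fun, heyting_rel) fo_formula" where
  "excluded_middle_eq = Eq (join_tm (Var 0) (neg_tm (Var 0))) top_tm"

definition double_negation_eq :: "(heyting_fun, heyting_rel) fo_formula" where
  "double_negation_eq = Eq (neg_tm (neg_tm (Var 0))) (Var 0)"


section \<open>Heyting algebras as ordered sets\<close>

locale heyting_algebra = bounded_lattice H for H (structure) +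
  assumes meet_join_distrib:
      "\<lbrakk>x \<in> carrier H; y \<in> carrier H; z \<in> carrier H\<rbrakk>
        \<Longrightarrow> x \<sqinter> (y \<squnion> z) = (x \<sqinter> y) \<squnion> (x \<sqinter> z)"
    and imp_exists:
      "\<lbrakk>x \<in> carrier H; y \<in> carrier H\<rbrakk> \<Longrightarrow> \<exists>m. greatest H m {z \<in> carrier H. x \<sqinter> z \<sqsubseteq> y}"

definition himp :: "('b, 'm) gorder_scheme \<Rightarrow> 'b \<Rightarrow> 'b \<Rightarrow> 'b" where
  "himp H x y = (SOME m. greatest H m {z \<in> carrier H. x \<sqinter>\<^bsub>H\<^esub> z \<sqsubseteq>\<^bsub>H\<^esub> y})"

definition hneg :: "('b, 'm) gorder_scheme \<Rightarrow> 'b \<Rightarrow> 'b" where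
  "hneg H x = himp H x \<bottom>\<^bsub>H\<^esub>"

definition definable_heyting_algebra ::
    "('f, 'p) fo_lang \<Rightarrow> ('f, 'p, 'a) fo_struct \<Rightarrow> nat \<Rightarrow> 'a list gorder \<Rightarrow> bool" where
  "definable_heyting_algebra L R k H \<longleftrightarrow>
     heyting_algebra H \<and> definable L R k (carrier H) \<and>
     definable L R (2 * k)
       {xs @ ys |xs ys. xs \<in> carrier H \<and> ys \<in> carrier H \<and> xs \<sqsubseteq>\<^bsub>H\<^esub> ys}"

end

theory Submission
  imports Defs
begin

text \<open>
  The regular elements \<open>\<not>\<not>x = x\<close> of a Heyting algebra form a Boolean algebra \<open>B\<close>, which contains
  all solutions of \<open>x \<squnion> \<not>x = \<top>\<close>. If the algebra is definable, then so is \<open>B\<close>, and \<open>B\<close> is finite because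
  an o-minimal structure has no infinite definable Boolean algebra: for a principal ideal \<open>[\<bottom>, x]\<close> of
  least dimension among the infinite ones, every \<open>y \<sqsubseteq> x\<close> has \<open>[\<bottom>, y]\<close> or \<open>[\<bottom>, x \<sqinter> \<not>y]\<close> finite, since
  dimensions of disjoint pieces add up; the elements with a finite principal ideal then form an
  infinite definable ideal \<open>F \<subseteq> [\<bottom>, x]\<close>, and the join \<open>F \<times> F \<rightarrow> F\<close> has finite fibres, which forces
  \<open>2 dim F \<le> dim F\<close>. So both equations have finitely many solutions, while an infinite definable set
  has dimension at least \<open>1\<close>.

  The dimension theory needed for this rests on one exchange property: if infinitely many columns of
  a definable subset of \<open>R\<^sup>2\<close> are infinite, then so are infinitely many rows.
\<close>

section \<open>Renaming of variables\<close>

text \<open>The dimension count runs on a rank instead of cells. \<open>rk\<close> peels off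
  coordinates from the left: either one fibre keeps the full rank, or infinitely many fibres have
  rank one less. Since a definable subset of \<open>R\<close> is infinite exactly when it contains
  an interval, lower bounds on the rank are definable conditions on parameters. Hence finiteness of
  \<open>[\<bottom>, y]\<close> is a definable condition on \<open>y\<close>, and this is why
  \<open>F\<close> is definable. The price is that the rank is a priori tied to the order of the
  coordinates; the exchange property lets a rank pass from a projection up to the set, and so makes
  finite-to-one maps such as the join usable. Cells enter only at the end, where little is asked of
  them: cells of positive dimension are infinite, and every infinite definable set contains a curve
  that is a 1-cell.

  The algebra is phrased through the order and pseudocomplements. Pseudocomplements and the joins of
  \<open>B\<close> are first-order over the order, so one argument serves both the models of the
  theory and the ordered sets, where only the order is assumed definable.\<close>

lemma finite_term_vars: "finite (term_vars t)"
  by (induction t) auto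

lemma finite_free_vars: "finite (free_vars \<phi>)"
  by (induction \<phi>) (auto simp: finite_term_vars)

lemma eval_term_cong: "(\<And>x. x \<in> term_vars t \<Longrightarrow> e x = e' x) \<Longrightarrow> eval_term M e t = eval_term M e' t"
proof (induction t)
  case (App f ts)
  then have "map (eval_term M e) ts = map (eval_term M e') ts"
    by (intro map_cong) auto
  then show ?case by (simp only: eval_term.simps)
qed simp

lemma sat_cong: "(\<And>x. x \<in> free_vars \<phi> \<Longrightarrow> e x = e' x) \<Longrightarrow> sat M e \<phi> \<longleftrightarrow> sat M e' \<phi>"
proof (induction \<phi> arbitrary: e e')
  case (Eq s t)
  have "eval_term M e s = eval_term M e' s" "eval_term M e t = eval_term M e' t"
    using Eq by (auto intro!: eval_term_cong)
  then show ?case by simp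
next
  case (Rel p ts)
  then have "map (eval_term M e) ts = map (eval_term M e') ts"
    by (intro map_cong refl eval_term_cong) auto
  then show ?case by (simp only: sat.simps)
next
  case (Neg \<phi>)
  then have "sat M e \<phi> \<longleftrightarrow> sat M e' \<phi>" by (intro Neg.IH) simp
  then show ?case by simp
next
  case (Conj \<phi> \<psi>)
  have "sat M e \<phi> \<longleftrightarrow> sat M e' \<phi>"
    by (rule Conj.IH(1)) (use Conj.prems in simp)
  moreover have "sat M e \<psi> \<longleftrightarrow> sat M e' \<psi>"
    by (rule Conj.IH(2)) (use Conj.prems in simp)
  ultimately show ?case by simp
next
  case (Exists x \<phi>)
  have "sat M (e(x := a)) \<phi> \<longleftrightarrow> sat M (e'(x := a)) \<phi>" for a
    by (rule Exists.IH) (use Exists.prems in auto)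
  then show ?case by simp
qed

primrec rename_term :: "(nat \<Rightarrow> nat) \<Rightarrow> 'f fo_term \<Rightarrow> 'f fo_term" where
  "rename_term r (Var x) = Var (r x)"
| "rename_term r (App f ts) = App f (map (rename_term r) ts)"

lemma eval_rename_term: "eval_term M e (rename_term r t) = eval_term M (e \<circ> r) t"
  by (induction t) (simp_all add: comp_def cong: map_cong)

lemma wf_rename_term: "wf_term L (rename_term r t) \<longleftrightarrow> wf_term L t"
  by (induction t) (auto simp: list_all_iff)

text \<open>Since \<open>r\<close> is arbitrary, a quantifier could capture a renamed free variable;
  the bound variable therefore moves to one outside the image of the free variables.\<close>

primrec rename :: "('f, 'p) fo_formula \<Rightarrow> (nat \<Rightarrow> nat) \<Rightarrow> ('f, 'p) fo_formula" where
  "rename (Eq s t) = (\<lambda>r. Eq (rename_term r s) (rename_term r t))"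
| "rename (Rel p ts) = (\<lambda>r. Rel p (map (rename_term r) ts))"
| "rename (Neg \<phi>) = (\<lambda>r. Neg (rename \<phi> r))"
| "rename (Conj \<phi> \<psi>) = (\<lambda>r. Conj (rename \<phi> r) (rename \<psi> r))"
| "rename (Exists x \<phi>) = (\<lambda>r. let z = SOME z. z \<notin> r ` free_vars \<phi>
     in Exists z (rename \<phi> (r(x := z))))"

lemma wf_rename: "wf_formula L (rename \<phi> r) \<longleftrightarrow> wf_formula L \<phi>"
  by (induction \<phi> arbitrary: r) (auto simp: wf_rename_term list_all_iff Let_def)

lemma sat_rename: "sat M e (rename \<phi> r) \<longleftrightarrow> sat M (e \<circ> r) \<phi>"
proof (induction \<phi> arbitrary: r e)
  case (Exists x \<phi>)
  define z where "z = (SOME z. z \<notin> r ` free_vars \<phi>)"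
  have "\<exists>z. z \<notin> r ` free_vars \<phi>"
    by (rule ex_new_if_finite) (auto simp: finite_free_vars)
  then have z: "z \<notin> r ` free_vars \<phi>"
    unfolding z_def by (rule someI_ex)
  have "sat M (e(z := a) \<circ> r(x := z)) \<phi> \<longleftrightarrow> sat M ((e \<circ> r)(x := a)) \<phi>" for a
    by (rule sat_cong) (use z in \<open>auto simp: comp_def\<close>)
  then show ?case
    by (simp only: rename.simps Let_def sat.simps Exists.IH flip: z_def)
qed (simp_all add: eval_rename_term comp_def cong: map_cong)


section \<open>Definable predicates, functions and vectors\<close>

context o_minimal_field
begin

text \<open>The predicate \<open>P\<close> of a point \<open>\<rho>\<close> is given by a formula whose variables are, as prescribed
  by \<open>\<sigma>\<close>, coordinates of \<open>\<rho>\<close> or parameters; \<open>\<sigma>\<close> need not be injective, which makes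
  substitutions of coordinates and of parameters immediate.\<close>

definition dfn :: "((nat \<Rightarrow> 'a) \<Rightarrow> bool) \<Rightarrow> bool" where
  "dfn P \<longleftrightarrow> (\<exists>\<phi> \<sigma>. wf_formula L \<phi> \<and> (\<forall>\<rho>. P \<rho> \<longleftrightarrow> sat R (\<lambda>j. case_sum \<rho> id (\<sigma> j)) \<phi>))"

lemma dfn_subst:
  assumes "dfn P" shows "dfn (\<lambda>\<rho>. P (\<lambda>i. case_sum \<rho> id (g i)))"
proof -
  obtain \<phi> \<sigma> where wf: "wf_formula L \<phi>" and P: "\<And>\<rho>. P \<rho> \<longleftrightarrow> sat R (\<lambda>j. case_sum \<rho> id (\<sigma> j)) \<phi>"
    using assms unfolding dfn_def by blast
  define \<sigma>' where "\<sigma>' j = case_sum g Inr (\<sigma> j)" for j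
  have "(\<lambda>j. case_sum (\<lambda>i. case_sum \<rho> id (g i)) id (\<sigma> j)) = (\<lambda>j. case_sum \<rho> id (\<sigma>' j))" for \<rho>
    by (auto simp: \<sigma>'_def split: sum.splits)
  then show ?thesis
    unfolding dfn_def P using wf by metis
qed

lemma dfn_reindex: "dfn P \<Longrightarrow> dfn (\<lambda>\<rho>. P (\<lambda>i. \<rho> (f i)))"
  using dfn_subst[of P "\<lambda>i. Inl (f i)"] by simp

lemma dfn_not: "dfn P \<Longrightarrow> dfn (\<lambda>\<rho>. \<not> P \<rho>)"
  unfolding dfn_def by (metis wf_formula.simps(3) sat.simps(3))

lemma dfn_conj:
  assumes "dfn P" "dfn Q" shows "dfn (\<lambda>\<rho>. P \<rho> \<and> Q \<rho>)"
proof -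
  obtain \<phi> \<sigma> where wf: "wf_formula L \<phi>" and P: "\<And>\<rho>. P \<rho> \<longleftrightarrow> sat R (\<lambda>j. case_sum \<rho> id (\<sigma> j)) \<phi>"
    using assms unfolding dfn_def by blast
  obtain \<psi> \<tau> where wf': "wf_formula L \<psi>" and Q: "\<And>\<rho>. Q \<rho> \<longleftrightarrow> sat R (\<lambda>j. case_sum \<rho> id (\<tau> j)) \<psi>"
    using assms unfolding dfn_def by blast
  \<comment> \<open>The variables of the two formulas go to even and odd numbers, so that
    \<open>\<sigma>\<close> and \<open>\<tau>\<close> can be interleaved into one
    prescription.\<close>
  define \<chi> where "\<chi> = Conj (rename \<phi> (\<lambda>i. 2 * i)) (rename \<psi> (\<lambda>i. Suc (2 * i)))"
  define \<upsilon> where "\<upsilon> j = (if even j then \<sigma> (j div 2) else \<tau> (j div 2))" for j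
  have "P \<rho> \<and> Q \<rho> \<longleftrightarrow> sat R (\<lambda>j. case_sum \<rho> id (\<upsilon> j)) \<chi>" for \<rho>
    unfolding \<chi>_def P Q by (simp add: sat_rename comp_def \<upsilon>_def)
  moreover have "wf_formula L \<chi>"
    using wf wf' by (simp add: \<chi>_def wf_rename)
  ultimately show ?thesis
    unfolding dfn_def by blast
qed

text \<open>De Bruijn convention: the quantified value is coordinate \<open>0\<close> and the old
  point is shifted up by one.\<close>

lemma dfn_ex:
  assumes "dfn (\<lambda>\<rho>. P (\<lambda>i. \<rho> (Suc i)) (\<rho> 0))" shows "dfn (\<lambda>\<rho>. \<exists>x. P \<rho> x)"
proof -
  obtain \<phi> \<sigma> where wf: "wf_formula L \<phi>"
    and P: "\<And>\<rho>. P (\<lambda>i. \<rho> (Suc i)) (\<rho> 0) \<longleftrightarrow> sat R (\<lambda>j. case_sum \<rho> id (\<sigma> j)) \<phi>"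
    using assms unfolding dfn_def by blast
  \<comment> \<open>Several variables may stand for coordinate \<open>0\<close>; all of them are
    merged into variable \<open>0\<close>, which the quantifier binds. The others move up by one, so
    \<open>\<tau>\<close> looks at \<open>j - 1\<close> and lowers the coordinate.\<close>
  define r where "r j = (if \<sigma> j = Inl 0 then 0 else Suc j)" for j
  define \<tau> where "\<tau> j = (case \<sigma> (j - 1) of Inl i \<Rightarrow> Inl (i - 1) | Inr c \<Rightarrow> Inr c)" for j :: nat
  have "(\<exists>x. P \<rho> x) \<longleftrightarrow> sat R (\<lambda>j. case_sum \<rho> id (\<tau> j)) (Exists 0 (rename \<phi> r))" for \<rho>
  proof -
    have "P \<rho> x \<longleftrightarrow> sat R ((\<lambda>j. case_sum \<rho> id (\<tau> j))(0 := x)) (rename \<phi> r)" for x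
    proof -
      have "((\<lambda>j. case_sum \<rho> id (\<tau> j))(0 := x)) \<circ> r = (\<lambda>j. case_sum (case_nat x \<rho>) id (\<sigma> j))"
        by (rule ext) (auto simp: r_def \<tau>_def split: sum.splits nat.splits)
      then show ?thesis
        using P[of "case_nat x \<rho>"] by (simp add: sat_rename)
    qed
    then show ?thesis by (simp add: univ_R)
  qed
  moreover have "wf_formula L (Exists 0 (rename \<phi> r))"
    using wf by (simp add: wf_rename)
  ultimately show ?thesis
    unfolding dfn_def by blast
qed

lemma dfn_all: "dfn (\<lambda>\<rho>. P (\<lambda>i. \<rho> (Suc i)) (\<rho> 0)) \<Longrightarrow> dfn (\<lambda>\<rho>. \<forall>x. P \<rho> x)"
  using dfn_not[OF dfn_ex[OF dfn_not]] by simp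

lemma dfn_disj: "dfn P \<Longrightarrow> dfn Q \<Longrightarrow> dfn (\<lambda>\<rho>. P \<rho> \<or> Q \<rho>)"
  using dfn_not[of "\<lambda>\<rho>. \<not> P \<rho> \<and> \<not> Q \<rho>"] by (simp add: dfn_conj dfn_not)

lemma dfn_imp: "dfn P \<Longrightarrow> dfn Q \<Longrightarrow> dfn (\<lambda>\<rho>. P \<rho> \<longrightarrow> Q \<rho>)"
  unfolding imp_conv_disj by (intro dfn_disj dfn_not)

lemma dfn_iff: "dfn P \<Longrightarrow> dfn Q \<Longrightarrow> dfn (\<lambda>\<rho>. P \<rho> \<longleftrightarrow> Q \<rho>)"
  unfolding iff_conv_conj_imp by (intro dfn_conj dfn_imp)

lemma dfn_var_eq: "dfn (\<lambda>\<rho>. \<rho> i = \<rho> j)"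
  unfolding dfn_def
  by (rule exI[of _ "Eq (Var 0) (Var 1)"], rule exI[of _ "\<lambda>x. if x = 0 then Inl i else Inl j"]) simp

lemma dfn_const: "dfn (\<lambda>\<rho>. b)"
  by (cases b) (use dfn_var_eq[of 0 0] dfn_not[OF dfn_var_eq[of 0 0]] in simp_all)

lemma dfn_ball_lessThan: "(\<And>j. j < n \<Longrightarrow> dfn (P j)) \<Longrightarrow> dfn (\<lambda>\<rho>. \<forall>j<n. P j \<rho>)" for n :: nat
proof (induction n)
  case (Suc n)
  then have "dfn (\<lambda>\<rho>. (\<forall>j<n. P j \<rho>) \<and> P n \<rho>)" by (intro dfn_conj) auto
  then show ?case unfolding less_Suc_eq by (simp add: imp_disjL all_conj_distrib)
qed (simp add: dfn_const)

lemma dfn_less_vars: "dfn (\<lambda>\<rho>. \<rho> i < \<rho> j)"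
proof -
  obtain p where p: "rel_arity L p = Some 2" "\<And>x y. rel_int R p [x, y] \<longleftrightarrow> x < y"
    using less_symbol by blast
  show ?thesis
    unfolding dfn_def
    by (rule exI[of _ "Rel p [Var 0, Var 1]"], rule exI[of _ "\<lambda>x. if x = 0 then Inl i else Inl j"])
      (simp add: p)
qed

section \<open>Definable functions, given by their graphs\<close>

definition dt :: "((nat \<Rightarrow> 'a) \<Rightarrow> 'a) \<Rightarrow> bool" where
  "dt t \<longleftrightarrow> dfn (\<lambda>\<rho>. \<rho> 0 = t (\<lambda>i. \<rho> (Suc i)))"

lemma dt_var: "dt (\<lambda>\<rho>. \<rho> i)"
  unfolding dt_def by (rule dfn_var_eq)

lemma dt_const: "dt (\<lambda>\<rho>. c)"
  unfolding dt_def
  using dfn_subst[OF dfn_var_eq[of 0 1], of "\<lambda>x. if x = 0 then Inl 0 else Inr c"] by simp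

lemma dt_reindex:
  assumes "dt t" shows "dt (\<lambda>\<rho>. t (\<lambda>i. \<rho> (f i)))"
proof -
  have "dfn (\<lambda>\<rho>. \<rho> 0 = t (\<lambda>i. \<rho> (Suc (f i))))"
    using dfn_reindex[OF assms[unfolded dt_def], of "case_nat 0 (\<lambda>i. Suc (f i))"] by simp
  then show ?thesis unfolding dt_def .
qed

lemma dfn_subst_term:
  assumes "dfn (\<lambda>\<rho>. P (\<lambda>i. \<rho> (Suc i)) (\<rho> 0))" "dt t" shows "dfn (\<lambda>\<rho>. P \<rho> (t \<rho>))"
proof -
  have "dfn (\<lambda>\<rho>. \<exists>x. x = t \<rho> \<and> P \<rho> x)"
    by (rule dfn_ex) (intro dfn_conj assms assms(2)[unfolded dt_def])
  then show ?thesis by simp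
qed

lemma dfn_subst_term2:
  assumes "dfn (\<lambda>\<rho>. P (\<rho> 0) (\<rho> 1))" "dt s" "dt t" shows "dfn (\<lambda>\<rho>. P (s \<rho>) (t \<rho>))"
proof -
  have "dfn (\<lambda>\<rho>. P (\<rho> 0) (t (\<lambda>i. \<rho> (Suc i))))"
    by (intro dfn_subst_term[where P = "\<lambda>\<rho>. P (\<rho> 0)"] dt_reindex[OF assms(3)])
      (use dfn_reindex[OF assms(1), of "\<lambda>i. 1 - i"] in simp)
  then show ?thesis
    by (intro dfn_subst_term[where P = "\<lambda>\<rho> x. P x (t \<rho>)"] assms(2))
qed

lemma dfn_eq: "dt s \<Longrightarrow> dt t \<Longrightarrow> dfn (\<lambda>\<rho>. s \<rho> = t \<rho>)"
  by (rule dfn_subst_term2[where P = "(=)"]) (rule dfn_var_eq)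

lemma dfn_less: "dt s \<Longrightarrow> dt t \<Longrightarrow> dfn (\<lambda>\<rho>. s \<rho> < t \<rho>)"
  by (rule dfn_subst_term2[where P = "(<)"]) (rule dfn_less_vars)

lemma dfn_le: "dt s \<Longrightarrow> dt t \<Longrightarrow> dfn (\<lambda>\<rho>. s \<rho> \<le> t \<rho>)"
  unfolding not_less[symmetric] by (intro dfn_not dfn_less)

lemma dt_compose:
  assumes "dt (\<lambda>\<rho>. g (\<rho> 0))" "dt t" shows "dt (\<lambda>\<rho>. g (t \<rho>))"
proof -
  have "dfn (\<lambda>\<rho>. \<rho> 0 = g (\<rho> 1))" using assms(1) by (simp add: dt_def)
  then show ?thesis
    unfolding dt_def by (rule dfn_subst_term2[where P = "\<lambda>x y. x = g y"]) (intro dt_var dt_reindex[OF assms(2)])+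
qed

lemma dt_binary:
  assumes "dfn (\<lambda>\<rho>. \<rho> 0 = g (\<rho> 1) (\<rho> 2))" "dt s" "dt t" shows "dt (\<lambda>\<rho>. g (s \<rho>) (t \<rho>))"
proof -
  have "dfn (\<lambda>\<rho>. \<exists>x. x = s (\<lambda>i. \<rho> (Suc i)) \<and> (\<exists>y. y = t (\<lambda>i. \<rho> (Suc i)) \<and> \<rho> 0 = g x y))"
    using dfn_reindex[OF assms(1), of "\<lambda>i. 2 - i"]
    by (intro dfn_ex dfn_conj) (auto simp: numeral_2_eq_2
        intro!: dfn_eq dt_var dt_reindex[OF assms(2)] dt_reindex[OF assms(3)])
  then show ?thesis unfolding dt_def by simp
qed

lemma dt_unary:
  assumes "fun_arity L f = Some 1" shows "dt (\<lambda>\<rho>. fun_int R f [\<rho> 0])"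
  unfolding dt_def dfn_def
  by (rule exI[of _ "Eq (Var 0) (App f [Var 1])"], rule exI[of _ Inl]) (simp add: assms)

lemma dfn_symbol2:
  assumes "fun_arity L f = Some 2" shows "dfn (\<lambda>\<rho>. \<rho> 0 = fun_int R f [\<rho> 1, \<rho> 2])"
  unfolding dfn_def
  by (rule exI[of _ "Eq (Var 0) (App f [Var 1, Var 2])"], rule exI[of _ Inl]) (simp add: assms)

lemma dt_minus: "dt s \<Longrightarrow> dt (\<lambda>\<rho>. - s \<rho>)"
proof (rule dt_compose[where g = uminus])
  obtain f where "fun_arity L f = Some 1" "\<And>x. fun_int R f [x] = - x"
    using minus_symbol by blast
  then show "dt (\<lambda>\<rho>. - \<rho> 0)" using dt_unary[of f] by simp
qed

lemma dt_plus: "dt s \<Longrightarrow> dt t \<Longrightarrow> dt (\<lambda>\<rho>. s \<rho> + t \<rho>)"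
proof (rule dt_binary[where g = "(+)"])
  obtain f where "fun_arity L f = Some 2" "\<And>x y. fun_int R f [x, y] = x + y"
    using plus_symbol by blast
  then show "dfn (\<lambda>\<rho>. \<rho> 0 = \<rho> 1 + \<rho> 2)" using dfn_symbol2[of f] by simp
qed

lemma dt_times: "dt s \<Longrightarrow> dt t \<Longrightarrow> dt (\<lambda>\<rho>. s \<rho> * t \<rho>)"
proof (rule dt_binary[where g = times])
  obtain f where "fun_arity L f = Some 2" "\<And>x y. fun_int R f [x, y] = x * y"
    using times_symbol by blast
  then show "dfn (\<lambda>\<rho>. \<rho> 0 = \<rho> 1 * \<rho> 2)" using dfn_symbol2[of f] by simp
qed

lemma dt_diff: "dt s \<Longrightarrow> dt t \<Longrightarrow> dt (\<lambda>\<rho>. s \<rho> - t \<rho>)"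
  unfolding diff_conv_add_uminus by (intro dt_plus dt_minus)

lemmas dfn_intros = dfn_ex dfn_all dfn_conj dfn_disj dfn_imp dfn_iff dfn_not dfn_less dfn_le dfn_eq
  dfn_const dt_plus dt_minus dt_times dt_diff dt_var dt_const

section \<open>Definable maps into a power of \<open>R\<close>\<close>

definition dv :: "nat \<Rightarrow> ((nat \<Rightarrow> 'a) \<Rightarrow> 'a list) \<Rightarrow> bool" where
  "dv n v \<longleftrightarrow> (\<forall>\<rho>. length (v \<rho>) = n) \<and> (\<forall>i<n. dt (\<lambda>\<rho>. v \<rho> ! i))"

lemma dv_length: "dv n v \<Longrightarrow> length (v \<rho>) = n"
  by (simp add: dv_def)

lemma dv_vars: "dv n (\<lambda>\<rho>. map (\<lambda>i. \<rho> (f i)) [0..<n])"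
  by (auto simp: dv_def dt_var)

lemma dv_point: "dv n (\<lambda>\<rho>. map \<rho> [0..<n])"
  using dv_vars[of n "\<lambda>i. i"] by simp

lemma dv_const: "length c = n \<Longrightarrow> dv n (\<lambda>\<rho>. c)"
  by (simp add: dv_def dt_const)

lemma dv_Nil: "dv 0 (\<lambda>\<rho>. [])"
  by (simp add: dv_def)

lemma dv_Cons: "dt t \<Longrightarrow> dv n v \<Longrightarrow> dv (Suc n) (\<lambda>\<rho>. t \<rho> # v \<rho>)"
  by (auto simp: dv_def less_Suc_eq_0_disj)

lemma dv_append: "dv m u \<Longrightarrow> dv n v \<Longrightarrow> dv (m + n) (\<lambda>\<rho>. u \<rho> @ v \<rho>)"
proof -
  assume u: "dv m u" and v: "dv n v"
  have "dt (\<lambda>\<rho>. (u \<rho> @ v \<rho>) ! i)" if "i < m + n" for i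
    using u v that by (cases "i < m") (simp_all add: dv_def nth_append)
  then show ?thesis using u v by (simp add: dv_def)
qed

lemma dv_snoc: "dv n v \<Longrightarrow> dt t \<Longrightarrow> dv (Suc n) (\<lambda>\<rho>. v \<rho> @ [t \<rho>])"
  using dv_append[OF _ dv_Cons[OF _ dv_Nil]] by simp

lemma dv_take: "dv n v \<Longrightarrow> m \<le> n \<Longrightarrow> dv m (\<lambda>\<rho>. take m (v \<rho>))"
  by (auto simp: dv_def)

lemma dv_drop: "dv (m + n) v \<Longrightarrow> dv n (\<lambda>\<rho>. drop m (v \<rho>))"
  by (auto simp: dv_def)

lemma dv_reindex: "dv n v \<Longrightarrow> dv n (\<lambda>\<rho>. v (\<lambda>i. \<rho> (f i)))"
  by (auto simp: dv_def intro: dt_reindex[of "\<lambda>\<rho>. v \<rho> ! _"])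

lemma dfn_vec_eq:
  assumes "dv n u" "dv n v" shows "dfn (\<lambda>\<rho>. u \<rho> = v \<rho>)"
proof -
  have "dfn (\<lambda>\<rho>. \<forall>i<n. u \<rho> ! i = v \<rho> ! i)"
    using assms by (intro dfn_ball_lessThan dfn_eq) (auto simp: dv_def)
  moreover have "u \<rho> = v \<rho> \<longleftrightarrow> (\<forall>i<n. u \<rho> ! i = v \<rho> ! i)" for \<rho>
    using assms by (auto simp: dv_def list_eq_iff_nth_eq)
  ultimately show ?thesis by simp
qed

text \<open>In the induction for \<open>dfn_ex_vec\<close> the tail is quantified inside the head,
  so the tail must occupy the coordinates below \<open>n\<close> and the head coordinate
  \<open>n\<close>.\<close>

lemma dfn_rotate:
  assumes "dfn (\<lambda>\<rho>. P (\<lambda>i. \<rho> (i + Suc n)) (map \<rho> [0..<Suc n]))"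
  shows "dfn (\<lambda>\<rho>. P (\<lambda>i. \<rho> (Suc i + n)) (\<rho> n # map \<rho> [0..<n]))"
proof -
  let ?f = "\<lambda>i. if i = 0 then n else if i \<le> n then i - 1 else i"
  have "map (\<lambda>i. \<rho> (?f i)) [0..<Suc n] = \<rho> n # map \<rho> [0..<n]" for \<rho> :: "nat \<Rightarrow> 'a"
    by (rule nth_equalityI) (auto simp del: upt_Suc simp: nth_Cons split: nat.splits)
  moreover have "(\<lambda>i. \<rho> (?f (i + Suc n))) = (\<lambda>i. \<rho> (Suc i + n))" for \<rho> :: "nat \<Rightarrow> 'a"
    by (rule ext) simp
  ultimately show ?thesis
    using dfn_reindex[OF assms, of ?f] by (simp del: upt_Suc)
qed

lemma dfn_ex_vec:
  assumes "dfn (\<lambda>\<rho>. P (\<lambda>i. \<rho> (i + n)) (map \<rho> [0..<n]))"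
  shows "dfn (\<lambda>\<rho>. \<exists>v. length v = n \<and> P \<rho> v)"
  using assms
proof (induction n arbitrary: P)
  case (Suc n)
  from Suc.IH[of "\<lambda>\<rho> v. P (\<lambda>i. \<rho> (Suc i)) (\<rho> 0 # v)"] dfn_rotate[OF Suc.prems]
  have "dfn (\<lambda>\<rho>. \<exists>v. length v = n \<and> P (\<lambda>i. \<rho> (Suc i)) (\<rho> 0 # v))"
    by simp
  then have "dfn (\<lambda>\<rho>. \<exists>x. \<exists>v. length v = n \<and> P \<rho> (x # v))"
    by (intro dfn_ex)
  moreover have "(\<exists>x. \<exists>v. length v = n \<and> P \<rho> (x # v)) \<longleftrightarrow> (\<exists>v. length v = Suc n \<and> P \<rho> v)" for \<rho>
    by (auto simp: length_Suc_conv)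
  ultimately show ?case by simp
qed simp

lemma dfn_all_vec:
  assumes "dfn (\<lambda>\<rho>. P (\<lambda>i. \<rho> (i + n)) (map \<rho> [0..<n]))"
  shows "dfn (\<lambda>\<rho>. \<forall>v. length v = n \<longrightarrow> P \<rho> v)"
  using dfn_not[OF dfn_ex_vec[where P = "\<lambda>\<rho> v. \<not> P \<rho> v", OF dfn_not[OF assms]]] by simp

text \<open>Only the points of length \<open>n\<close> are tested, so fibres and projections can be
  formed as plain set comprehensions without a length condition.\<close>

definition dset :: "nat \<Rightarrow> 'a list set \<Rightarrow> bool" where
  "dset n X \<longleftrightarrow> dfn (\<lambda>\<rho>. map \<rho> [0..<n] \<in> X)"

lemma dfn_mem:
  assumes "dset n X" "dv n v" shows "dfn (\<lambda>\<rho>. v \<rho> \<in> X)"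
proof -
  have "dfn (\<lambda>\<rho>. \<exists>w. length w = n \<and> w = v \<rho> \<and> w \<in> X)"
    using assms(1)
    by (intro dfn_ex_vec dfn_conj dfn_vec_eq[of n] dv_point dv_reindex[OF assms(2)])
      (simp add: dset_def)
  then show ?thesis using dv_length[OF assms(2)] by simp
qed

lemma dset_Collect: "dfn (\<lambda>\<rho>. P (map \<rho> [0..<n])) \<Longrightarrow> dset n {v. P v}"
  by (simp add: dset_def)

lemma definable_imp_dset:
  assumes "definable L R n X" shows "dset n X"
proof -
  obtain \<phi> e where wf: "wf_formula L \<phi>"
    and X: "X = {xs \<in> tuples n (univ R). sat R (\<lambda>i. if i < n then xs ! i else e i) \<phi>}"
    using assms unfolding definable_def by blast
  define \<sigma> where "\<sigma> j = (if j < n then Inl j else Inr (e j))" for j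
  have "map \<rho> [0..<n] \<in> X \<longleftrightarrow> sat R (\<lambda>j. case_sum \<rho> id (\<sigma> j)) \<phi>" for \<rho>
  proof -
    have "(\<lambda>i. if i < n then map \<rho> [0..<n] ! i else e i) = (\<lambda>j. case_sum \<rho> id (\<sigma> j))"
      by (rule ext) (simp add: \<sigma>_def)
    then show ?thesis unfolding X tuples_def by (simp add: univ_R)
  qed
  then show ?thesis
    unfolding dset_def dfn_def using wf by blast
qed

lemma definable_length: "definable L R n X \<Longrightarrow> xs \<in> X \<Longrightarrow> length xs = n"
  by (auto simp: definable_def tuples_def)

lemma dset_imp_definable:
  assumes "dset n X" "\<And>xs. xs \<in> X \<Longrightarrow> length xs = n" shows "definable L R n X"
proof -
  obtain \<phi> \<sigma> where wf: "wf_formula L \<phi>"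
    and X: "\<And>\<rho>. map \<rho> [0..<n] \<in> X \<longleftrightarrow> sat R (\<lambda>j. case_sum \<rho> id (\<sigma> j)) \<phi>"
    using assms unfolding dfn_def dset_def by blast
  \<comment> \<open>A formula for membership may mention coordinates from \<open>n\<close> on,
    although the truth value does not depend on them. All of these become variable \<open>n\<close>,
    with value \<open>0\<close>; the parameter prescribed at \<open>j\<close> becomes variable
    \<open>n + 1 + j\<close>.\<close>
  define r where "r j = (case \<sigma> j of Inl i \<Rightarrow> if i < n then i else n | Inr c \<Rightarrow> n + 1 + j)" for j
  define e where "e j = (if j = n then 0 else case \<sigma> (j - n - 1) of Inl _ \<Rightarrow> 0 | Inr c \<Rightarrow> c)" for j
  have "xs \<in> X \<longleftrightarrow> sat R (\<lambda>i. if i < n then xs ! i else e i) (rename \<phi> r)" if "length xs = n" for xs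
  proof -
    have "(\<lambda>i. if i < n then xs ! i else e i) \<circ> r
      = (\<lambda>j. case_sum (\<lambda>i. if i < n then xs ! i else 0) id (\<sigma> j))"
      by (rule ext) (auto simp: r_def e_def split: sum.splits)
    moreover have "map (\<lambda>i. if i < n then xs ! i else 0) [0..<n] = xs"
      using that by (auto simp: list_eq_iff_nth_eq)
    ultimately show ?thesis
      using X[of "\<lambda>i. if i < n then xs ! i else 0"] by (simp add: sat_rename)
  qed
  then have "X = {xs \<in> tuples n (univ R). sat R (\<lambda>i. if i < n then xs ! i else e i) (rename \<phi> r)}"
    using assms(2) by (auto simp: tuples_def univ_R)
  then show ?thesis
    unfolding definable_def using wf
    by (intro exI[of _ "rename \<phi> r"] exI[of _ e]) (simp add: wf_rename univ_R)
qed

end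


section \<open>Consequences of o-minimality in one variable\<close>

lemma component_convex:
  assumes "open_interval I \<or> (\<exists>a. I = {a})" "x \<in> I" "y \<in> I" "x < z" "z < y"
  shows "z \<in> I"
  using assms unfolding open_interval_def by auto

text \<open>\<open>R\<close> need not be order complete. A bounded component still has a supremum
  because its endpoints lie in \<open>R\<close>; a component unbounded above contradicts
  \<open>M\<close>.\<close>

lemma component_sup:
  fixes I :: "'a::linordered_field set"
  assumes "open_interval I \<or> (\<exists>a. I = {a})" "I \<noteq> {}" "\<And>x. x \<in> I \<Longrightarrow> x \<le> M"
  shows "\<exists>L. (\<forall>x\<in>I. x \<le> L) \<and> (\<forall>y<L. \<exists>x\<in>I. y < x)"
proof -
  consider "I = UNIV" | a where "I = {a<..}" | b where "I = {..<b}" | a b where "I = {a<..<b}" | a where "I = {a}"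
    using assms(1) unfolding open_interval_def by blast
  then show ?thesis
  proof cases
    case 1
    then show ?thesis using assms(3) gt_ex[of M] by (metis UNIV_I not_le)
  next
    case (2 a)
    obtain x where "max a M < x" using gt_ex by blast
    then show ?thesis using assms(3)[of x] 2 by simp
  next
    case (3 b)
    then show ?thesis using dense by (intro exI[of _ b]) (auto simp: less_imp_le)
  next
    case (4 a b)
    have "\<exists>x\<in>I. y < x" if "y < b" for y
      using dense[of "max a y" b] that assms(2) 4 by auto
    then show ?thesis using 4 by (intro exI[of _ b]) (auto simp: less_imp_le)
  next
    case (5 a)
    then show ?thesis by auto
  qed
qed

lemma sup_Union:
  fixes F :: "'a::linorder set set"
  assumes "finite F" "\<And>I. I \<in> F \<Longrightarrow> I \<noteq> {} \<Longrightarrow> \<exists>L. (\<forall>x\<in>I. x \<le> L) \<and> (\<forall>y<L. \<exists>x\<in>I. y < x)"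
    and "\<Union>F \<noteq> {}"
  shows "\<exists>L. (\<forall>x\<in>\<Union>F. x \<le> L) \<and> (\<forall>y<L. \<exists>x\<in>\<Union>F. y < x)"
  using assms
proof (induction F)
  case (insert I F)
  show ?case
  proof (cases "I = {} \<or> \<Union>F = {}")
    case True
    then show ?thesis
    proof
      assume "I = {}"
      then have eq: "\<Union>(insert I F) = \<Union>F" by simp
      have "\<exists>L. (\<forall>x\<in>J. x \<le> L) \<and> (\<forall>y<L. \<exists>x\<in>J. y < x)" if "J \<in> F" "J \<noteq> {}" for J
        using insert.prems(1)[of J] that by blast
      then show ?thesis
        using insert.IH insert.prems(2) unfolding eq by blast
    next
      assume "\<Union>F = {}"
      then have eq: "\<Union>(insert I F) = I" by (simp only: Union_insert Un_empty_right)
      show ?thesis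
        using insert.prems(1)[of I] insert.prems(2) unfolding eq by blast
    qed
  next
    case False
    obtain K where K: "\<forall>x\<in>I. x \<le> K" "\<forall>y<K. \<exists>x\<in>I. y < x"
      using insert.prems(1)[of I] False by blast
    obtain L where L: "\<forall>x\<in>\<Union>F. x \<le> L" "\<forall>y<L. \<exists>x\<in>\<Union>F. y < x"
      using insert.IH insert.prems(1) False by blast
    have "\<exists>x\<in>\<Union>(insert I F). y < x" if "y < max K L" for y
      using that K(2) L(2) unfolding less_max_iff_disj by blast
    moreover have "\<forall>x\<in>\<Union>(insert I F). x \<le> max K L"
      using K(1) L(1) by (auto simp: le_max_iff_disj)
    ultimately show ?thesis by blast
  qed
qed simp

context o_minimal_field
begin

lemma components:
  assumes "dfn (\<lambda>\<rho>. P (\<rho> 0))"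
  obtains F where "finite F" "\<And>I. I \<in> F \<Longrightarrow> open_interval I \<or> (\<exists>a. I = {a})" "{x. P x} = \<Union>F"
proof -
  have "definable L R 1 {xs. length xs = 1 \<and> P (xs ! 0)}"
    by (rule dset_imp_definable) (simp_all add: dset_def assms)
  from o_minimal[OF this] show ?thesis using that by auto
qed

text \<open>One of the finitely many components is infinite, and by convexity the interval between
  two of its points lies inside it.\<close>

lemma infinite_contains_interval:
  assumes "dfn (\<lambda>\<rho>. P (\<rho> 0))" "infinite {x. P x}"
  shows "\<exists>a b. a < b \<and> (\<forall>x. a < x \<and> x < b \<longrightarrow> P x)"
proof -
  obtain F where F: "finite F" "\<And>I. I \<in> F \<Longrightarrow> open_interval I \<or> (\<exists>a. I = {a})" "{x. P x} = \<Union>F"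
    using components[OF assms(1)] by blast
  obtain I where I: "I \<in> F" "infinite I"
    using assms(2) F(1,3) by (metis finite_Union)
  obtain x where "x \<in> I" using I(2) by (metis finite.emptyI ex_in_conv)
  moreover obtain y where "y \<in> I" "y \<noteq> x"
    using I(2) by (metis finite.emptyI finite_insert insertI1 insert_absorb singletonD subsetI
        finite_subset singleton_iff)
  ultimately obtain a b where "a \<in> I" "b \<in> I" "a < b"
    by (metis linorder_neq_iff)
  then show ?thesis using component_convex[OF F(2)[OF I(1)]] I(1) F(3) by blast
qed

lemma interval_infinite: "a < b \<Longrightarrow> (\<And>x. a < x \<Longrightarrow> x < b \<Longrightarrow> P x) \<Longrightarrow> infinite {x. P x}"
  for a :: 'a
  by (rule infinite_super[of "{a<..<b}"]) (auto simp: infinite_Ioo)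

text \<open>Containing an interval is a first-order condition, so being infinite is definable
  uniformly in the parameters. The definability of the rank rests on this.\<close>

lemma dfn_infinite:
  assumes "dfn (\<lambda>\<rho>. Q (\<lambda>i. \<rho> (Suc i)) (\<rho> 0))" shows "dfn (\<lambda>\<rho>. infinite {x. Q \<rho> x})"
proof -
  have "infinite {x. Q \<rho> x} \<longleftrightarrow> (\<exists>a b. a < b \<and> (\<forall>x. a < x \<and> x < b \<longrightarrow> Q \<rho> x))" for \<rho>
  proof
    have "dfn (\<lambda>\<rho>'. Q \<rho> (\<rho>' 0))"
      using dfn_subst[OF assms, of "case_nat (Inl 0) (\<lambda>i. Inr (\<rho> i))"] by simp
    then show "infinite {x. Q \<rho> x} \<Longrightarrow> \<exists>a b. a < b \<and> (\<forall>x. a < x \<and> x < b \<longrightarrow> Q \<rho> x)"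
      by (rule infinite_contains_interval)
  qed (use interval_infinite[where P = "Q \<rho>"] in blast)
  moreover have "dfn (\<lambda>\<rho>. \<exists>a b. a < b \<and> (\<forall>x. a < x \<and> x < b \<longrightarrow> Q \<rho> x))"
    using dfn_reindex[OF assms, of "case_nat 0 (\<lambda>i. i + 3)"]
    by (intro dfn_intros) (simp add: numeral_3_eq_3)
  ultimately show ?thesis by simp
qed

text \<open>Of finitely many components one must come arbitrarily close to \<open>a\<close> from the
  right, and convexity closes the gap.\<close>

lemma germ:
  assumes "dfn (\<lambda>\<rho>. P (\<rho> 0))" "\<And>b. a < b \<Longrightarrow> \<exists>x. a < x \<and> x < b \<and> P x"
  shows "\<exists>b>a. \<forall>x. a < x \<and> x < b \<longrightarrow> P x"
proof -
  obtain F where F: "finite F" "\<And>I. I \<in> F \<Longrightarrow> open_interval I \<or> (\<exists>a. I = {a})" "{x. P x} = \<Union>F"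
    using components[OF assms(1)] by blast
  have "\<exists>I\<in>F. \<forall>b>a. \<exists>x\<in>I. a < x \<and> x < b"
  proof (rule ccontr)
    assume "\<not> ?thesis"
    then obtain b where b: "\<And>I. I \<in> F \<Longrightarrow> b I > a" "\<And>I x. I \<in> F \<Longrightarrow> x \<in> I \<Longrightarrow> a < x \<Longrightarrow> \<not> x < b I"
      by metis
    define m where "m = Min (insert (a + 1) (b ` F))"
    have "m > a" using b(1) F(1) by (simp add: m_def)
    then obtain x where x: "a < x" "x < m" "P x" using assms(2) by blast
    then obtain I where "I \<in> F" "x \<in> I" using F(3) by blast
    moreover have "m \<le> b I" if "I \<in> F" for I using that F(1) by (simp add: m_def)
    ultimately show False using b(2)[of I x] x by force
  qed
  then obtain I where I: "I \<in> F" "\<And>b. b > a \<Longrightarrow> \<exists>x\<in>I. a < x \<and> x < b" by blast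
  obtain b where b: "b \<in> I" "a < b" using I(2)[of "a + 1"] by auto
  have "P x" if "a < x" "x < b" for x
    using I(2)[OF that(1)] component_convex[OF F(2)[OF I(1)]] b(1) that I(1) F(3) by blast
  then show ?thesis using b(2) by blast
qed

lemma definable_sup:
  assumes "dfn (\<lambda>\<rho>. P (\<rho> 0))" "P x0" "\<And>x. P x \<Longrightarrow> x \<le> M"
  shows "\<exists>L. (\<forall>x. P x \<longrightarrow> x \<le> L) \<and> (\<forall>y<L. \<exists>x. P x \<and> y < x)"
proof -
  obtain F where F: "finite F" "\<And>I. I \<in> F \<Longrightarrow> open_interval I \<or> (\<exists>a. I = {a})" "{x. P x} = \<Union>F"
    using components[OF assms(1)] by blast
  have "\<exists>L. (\<forall>x\<in>\<Union>F. x \<le> L) \<and> (\<forall>y<L. \<exists>x\<in>\<Union>F. y < x)"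
  proof (rule sup_Union[OF F(1)])
    fix I assume "I \<in> F" "I \<noteq> {}"
    then show "\<exists>L. (\<forall>x\<in>I. x \<le> L) \<and> (\<forall>y<L. \<exists>x\<in>I. y < x)"
      using F assms(3) by (intro component_sup) auto
  qed (use F(3) assms(2) in blast)
  then show ?thesis unfolding F(3)[symmetric] by auto
qed

text \<open>Each \<open>s\<close> that leaves the levels has a threshold, the point beyond which
  \<open>U s\<close> fails. Were there finitely many thresholds, a level below all of them would
  contain the whole union. Otherwise the thresholds fill an interval, and points with distinct
  thresholds above some \<open>k\<close> are distinct and lie in level \<open>k\<close>.\<close>

lemma infinite_level:
  assumes U: "dfn (\<lambda>\<rho>. U (\<rho> 0) (\<rho> 1))"
    and anti: "\<And>s e e'. U s e \<Longrightarrow> 0 < e' \<Longrightarrow> e' \<le> e \<Longrightarrow> U s e'"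
    and inf: "infinite {s. \<exists>e>0. U s e}"
  shows "\<exists>e>0. infinite {s. U s e}"
proof (rule ccontr)
  assume "\<not> ?thesis"
  then have fin: "\<And>e. e > 0 \<Longrightarrow> finite {s. U s e}" by blast
  \<comment> \<open>\<open>V v\<close> says that \<open>v\<close> is a threshold; whether
    \<open>U s v\<close> itself holds is left open.\<close>
  define V where "V v \<longleftrightarrow> 0 < v \<and> (\<exists>s. (\<forall>e. 0 < e \<and> e < v \<longrightarrow> U s e) \<and> (\<forall>e. v < e \<longrightarrow> \<not> U s e))" for v
  have "dfn (\<lambda>\<rho>. V (\<rho> 0))"
    unfolding V_def by (intro dfn_intros dfn_subst_term2[OF U])
  have r: "\<exists>v. V v \<and> (\<forall>e. 0 < e \<and> e < v \<longrightarrow> U s e) \<and> (\<forall>e. v < e \<longrightarrow> \<not> U s e)"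
    if "U s d" "d > 0" "\<not> U s 1" for s d
  proof -
    have "dfn (\<lambda>\<rho>. 0 < \<rho> 0 \<and> U s (\<rho> 0))"
      by (intro dfn_intros dfn_subst_term2[OF U])
    moreover have "x \<le> 1" if "0 < x \<and> U s x" for x
      using that anti[of s x 1] \<open>\<not> U s 1\<close> by (meson linear zero_less_one)
    ultimately obtain v where v: "\<forall>x. 0 < x \<and> U s x \<longrightarrow> x \<le> v" "\<forall>y<v. \<exists>x. (0 < x \<and> U s x) \<and> y < x"
      using definable_sup[of "\<lambda>x. 0 < x \<and> U s x" d 1] \<open>U s d\<close> \<open>d > 0\<close> by blast
    have "0 < v" using v(1) \<open>U s d\<close> \<open>d > 0\<close> by force
    moreover have "\<forall>e. 0 < e \<and> e < v \<longrightarrow> U s e" using v(2) anti less_imp_le by blast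
    moreover have "\<forall>e. v < e \<longrightarrow> \<not> U s e" using v(1) \<open>0 < v\<close> by (meson less_trans not_le)
    ultimately show ?thesis unfolding V_def by blast
  qed
  have "infinite {v. V v}"
  proof
    assume finV: "finite {v. V v}"
    \<comment> \<open>The \<open>1\<close> takes care of the points with \<open>U s 1\<close>, which
      need not have a threshold.\<close>
    define m where "m = Min (insert 1 {v. V v})"
    have m: "m > 0" "m \<le> 1" "\<And>v. V v \<Longrightarrow> m \<le> v"
      using finV by (auto simp: m_def V_def)
    have "{s. \<exists>e>0. U s e} \<subseteq> {s. U s (m / 2)}"
    proof clarify
      fix s e :: 'a assume e: "0 < e" "U s e"
      show "U s (m / 2)"
      proof (cases "U s 1")
        case True
        then show ?thesis using anti[of s 1 "m / 2"] m by simp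
      next
        case False
        then obtain v where "V v" "\<forall>e. 0 < e \<and> e < v \<longrightarrow> U s e" using r e by blast
        moreover have "m / 2 < v" using m(1) m(3)[OF \<open>V v\<close>] by (simp add: field_simps)
        ultimately show ?thesis using m(1) by simp
      qed
    qed
    then show False using fin[of "m / 2"] m(1) inf finite_subset by auto
  qed
  then obtain c d where cd: "c < d" "\<And>v. c < v \<Longrightarrow> v < d \<Longrightarrow> V v"
    using infinite_contains_interval[OF \<open>dfn (\<lambda>\<rho>. V (\<rho> 0))\<close>] by blast
  \<comment> \<open>Only thresholds above this interior point are used, so that all chosen points
    belong to the single level \<open>k\<close>.\<close>
  define k where "k = (c + d) / 2"
  have k: "c < k" "k < d" using cd(1) by (simp_all add: k_def field_simps)
  have "k > 0" using cd(2)[OF k] by (simp add: V_def)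
  define s where "s v = (SOME s. (\<forall>e. 0 < e \<and> e < v \<longrightarrow> U s e) \<and> (\<forall>e. v < e \<longrightarrow> \<not> U s e))" for v
  have s: "\<forall>e. 0 < e \<and> e < v \<longrightarrow> U (s v) e" "\<forall>e. v < e \<longrightarrow> \<not> U (s v) e" if "V v" for v
    using that someI_ex[of "\<lambda>s. (\<forall>e. 0 < e \<and> e < v \<longrightarrow> U s e) \<and> (\<forall>e. v < e \<longrightarrow> \<not> U s e)"]
    unfolding V_def s_def by blast+
  have Vk: "V v" if "v \<in> {k<..<d}" for v using that k cd(2) by auto
  have "inj_on s {k<..<d}"
  proof (rule linorder_inj_onI)
    fix v w assume "v < w" "v \<in> {k<..<d}" "w \<in> {k<..<d}"
    moreover obtain e where "v < e" "e < w" using dense \<open>v < w\<close> by blast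
    ultimately show "s v \<noteq> s w" using s[OF Vk] \<open>k > 0\<close> by (metis greaterThanLessThan_iff less_trans)
  qed auto
  moreover have "s ` {k<..<d} \<subseteq> {s. U s k}"
    using s(1)[OF Vk] \<open>k > 0\<close> by auto
  ultimately show False
    using fin[OF \<open>k > 0\<close>] infinite_Ioo[OF k(2)] by (metis finite_imageD finite_subset)
qed

text \<open>Infinitely many of the fibres contain intervals of a common length whose midpoints are
  bounded; the midpoints then cluster at some \<open>t\<close>, which lies in infinitely many of these intervals.\<close>

lemma infinite_fibres_common_point:
  assumes S: "dfn (\<lambda>\<rho>. S (\<rho> 0) (\<rho> 1))" and inf: "infinite {s. infinite {t. S s t}}"
  shows "\<exists>t. infinite {s. S s t}"
proof -
  \<comment> \<open>\<open>m\<close> is the midpoint and \<open>e\<close> the radius of an interval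
    in the fibre. Asking \<open>\<bar>m * e\<bar> \<le> 1\<close> bounds the midpoint by
    \<open>1 / e\<close>, so one parameter controls both length and position, and the condition
    weakens as \<open>e\<close> shrinks.\<close>
  define W where "W s m e \<longleftrightarrow> m * e \<le> 1 \<and> - 1 \<le> m * e \<and> (\<forall>x. m - e < x \<and> x < m + e \<longrightarrow> S s x)"
    for s m e
  define U where "U s e \<longleftrightarrow> (\<exists>m. W s m e)" for s e
  have dW: "dfn (\<lambda>\<rho>. W (s \<rho>) (m \<rho>) (e \<rho>))" if "dt s" "dt m" "dt e" for s m e
    unfolding W_def
    by (intro dfn_intros dfn_subst_term2[OF S] that dt_reindex[OF that(1)] dt_reindex[OF that(2)]
        dt_reindex[OF that(3)])
  have dU: "dfn (\<lambda>\<rho>. U (\<rho> 0) (\<rho> 1))"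
    unfolding U_def by (intro dfn_intros dW)
  have anti: "U s e'" if u: "U s e" "0 < e'" "e' \<le> e" for s e e'
  proof -
    obtain m where m: "W s m e" using u(1) unfolding U_def by blast
    have "\<bar>m * e'\<bar> \<le> \<bar>m * e\<bar>" using u by (simp add: abs_mult mult_left_mono)
    moreover have "\<bar>m * e\<bar> \<le> 1" using m by (simp add: W_def abs_le_iff)
    ultimately have "\<bar>m * e'\<bar> \<le> 1" by simp
    then have "W s m e'" using m u(3) unfolding W_def by (auto simp: abs_le_iff)
    then show ?thesis unfolding U_def by blast
  qed
  have "{s. infinite {t. S s t}} \<subseteq> {s. \<exists>e>0. U s e}"
  proof clarify
    fix s assume "infinite {t. S s t}"
    moreover have "dfn (\<lambda>\<rho>. S s (\<rho> 0))" by (intro dfn_subst_term2[OF S] dfn_intros)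
    ultimately obtain a b where ab: "a < b" "\<And>x. a < x \<Longrightarrow> x < b \<Longrightarrow> S s x"
      using infinite_contains_interval by blast
    define m where "m = (a + b) / 2"
    \<comment> \<open>The first bound keeps the interval inside the fibre, the second gives
      \<open>\<bar>m\<bar> * e \<le> 1\<close>.\<close>
    define e where "e = min ((b - a) / 2) (1 / (1 + \<bar>m\<bar>))"
    have "e > 0" using ab(1) by (simp add: e_def add_pos_nonneg)
    have "e \<le> 1 / (1 + \<bar>m\<bar>)" unfolding e_def by (rule min.cobounded2)
    then have "\<bar>m\<bar> * e \<le> 1"
      using \<open>e > 0\<close> by (simp add: le_divide_eq add_pos_nonneg distrib_left) (simp add: mult.commute)
    then have "\<bar>m * e\<bar> \<le> 1" using \<open>e > 0\<close> by (simp add: abs_mult)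
    moreover have "e \<le> (b - a) / 2" unfolding e_def by (rule min.cobounded1)
    then have "a \<le> m - e" "m + e \<le> b" by (simp_all add: m_def field_simps)
    ultimately have "W s m e" using ab(2) unfolding W_def by (auto simp: abs_le_iff)
    then show "\<exists>e>0. U s e" using \<open>e > 0\<close> unfolding U_def by blast
  qed
  then have "infinite {s. \<exists>e>0. U s e}" using inf finite_subset by blast
  have "\<exists>e>0. infinite {s. U s e}"
    by (rule infinite_level) (fact dU, fact anti, fact)
  then obtain e where e: "e > 0" "infinite {s. U s e}"
    by (elim exE conjE)
  have "dfn (\<lambda>\<rho>. U (\<rho> 0) e)" by (intro dfn_subst_term2[OF dU] dfn_intros)
  from infinite_contains_interval[OF this e(2)]
  obtain a b where ab: "a < b" "\<And>s. a < s \<Longrightarrow> s < b \<Longrightarrow> U s e"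
    by blast
  have bound: "- (1 / e) \<le> m" "m \<le> 1 / e" if "W s m e" for s m
  proof -
    have "- 1 \<le> m * e" "m * e \<le> 1" using that unfolding W_def by auto
    then show "- (1 / e) \<le> m" "m \<le> 1 / e" using e(1) by (simp_all add: field_simps)
  qed
  \<comment> \<open>The supremum \<open>l\<close> of \<open>C\<close> is the upper limit of the
    midpoints as \<open>s\<close> tends to \<open>a\<close> from the right.\<close>
  define C where "C c \<longleftrightarrow> (\<forall>d>a. \<exists>s. a < s \<and> s < d \<and> (\<exists>m\<ge>c. W s m e))" for c
  have dC: "dfn (\<lambda>\<rho>. C (\<rho> 0))"
    unfolding C_def by (intro dfn_intros dW)
  have "C (- (1 / e))"
    unfolding C_def
  proof clarify
    fix d assume "a < d"
    obtain s where "a < s" "s < min b d" using dense[of a "min b d"] \<open>a < d\<close> ab(1) by auto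
    then show "\<exists>s>a. s < d \<and> (\<exists>m\<ge>- (1 / e). W s m e)"
      using ab(2)[of s] bound(1) unfolding U_def by auto
  qed
  moreover have "c \<le> 1 / e" if c: "C c" for c
  proof -
    obtain d where "a < d" using gt_ex by blast
    then obtain s m where "c \<le> m" "W s m e" using c unfolding C_def by blast
    then show ?thesis using bound(2) order_trans by blast
  qed
  ultimately obtain l where l: "\<forall>c. C c \<longrightarrow> c \<le> l" "\<forall>y<l. \<exists>c. C c \<and> y < c"
    using definable_sup[OF dC] by blast
  obtain c where c: "C c" "l - e / 2 < c" using l(2) e(1) by (metis diff_less_eq half_gt_zero less_add_same_cancel1)
  have "\<not> C (l + e / 2)" using l(1) e(1) by force
  then obtain d where d: "d > a" "\<And>s m. a < s \<Longrightarrow> s < d \<Longrightarrow> W s m e \<Longrightarrow> m < l + e / 2"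
    unfolding C_def by (meson not_le)
  \<comment> \<open>Arbitrarily close to \<open>a\<close> some midpoint is within
    \<open>e / 2\<close> of \<open>l\<close>, so the interval of radius \<open>e\<close> around it
    contains \<open>l\<close>.\<close>
  have "\<exists>s. a < s \<and> s < h \<and> S s l" if ah: "a < h" for h
  proof -
    have "a < min d h" using d(1) ah by simp
    then obtain s m where s: "a < s" "s < min d h" "m \<ge> c" "W s m e"
      using c(1) unfolding C_def by blast
    have "m < l + e / 2" using d(2) s by simp
    then have "m - e < l" "l < m + e" using s(3) c(2) e(1) by (simp_all add: field_simps)
    then have "S s l" using s(4) unfolding W_def by blast
    then show ?thesis using s by auto
  qed
  moreover have "dfn (\<lambda>\<rho>. S (\<rho> 0) l)" by (intro dfn_subst_term2[OF S] dfn_intros)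
  ultimately obtain h where "h > a" "\<And>s. a < s \<Longrightarrow> s < h \<Longrightarrow> S s l"
    using germ[of "\<lambda>s. S s l" a] by blast
  then show ?thesis using interval_infinite[of a h "\<lambda>s. S s l"] by blast
qed

text \<open>If only finitely many rows were infinite, deleting them would leave infinitely many
  columns infinite. A common point of these columns is then an infinite row among the rows that were
  kept.\<close>

lemma infinite_fibres_swap:
  assumes S: "dfn (\<lambda>\<rho>. S (\<rho> 0) (\<rho> 1))" and inf: "infinite {s. infinite {t. S s t}}"
  shows "infinite {t. infinite {s. S s t}}"
proof
  define W where "W = {t. infinite {s. S s t}}"
  define N where "N s t \<longleftrightarrow> S s t \<and> t \<notin> W" for s t
  assume "finite {t. infinite {s. S s t}}"
  then have fin: "finite W" by (simp add: W_def)
  have "dfn (\<lambda>\<rho>. infinite {s. S s (\<rho> 0)})"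
    by (intro dfn_infinite dfn_subst_term2[OF S] dfn_intros)
  then have "dfn (\<lambda>\<rho>. \<rho> 1 \<in> W)"
    using dfn_reindex[of "\<lambda>\<rho>. \<rho> 0 \<in> W" "\<lambda>i. 1"] by (simp add: W_def)
  then have "dfn (\<lambda>\<rho>. N (\<rho> 0) (\<rho> 1))"
    unfolding N_def by (intro dfn_conj dfn_not S)
  moreover have "infinite {t. N s t}" if "infinite {t. S s t}" for s
  proof
    assume "finite {t. N s t}"
    moreover have "{t. S s t} \<subseteq> {t. N s t} \<union> W" by (auto simp: N_def)
    ultimately show False using that fin by (meson finite_UnI finite_subset)
  qed
  then have "infinite {s. infinite {t. N s t}}"
    by (intro infinite_super[OF _ inf]) auto
  ultimately have "\<exists>t. infinite {s. N s t}"
    by (rule infinite_fibres_common_point)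
  then obtain t where t: "infinite {s. N s t}" by (elim exE)
  show False
  proof (cases "t \<in> W")
    case True
    then show ?thesis using t by (simp add: N_def)
  next
    case False
    then show ?thesis using t by (simp add: N_def W_def)
  qed
qed

end


section \<open>Rank\<close>

text \<open>\<open>rk n d X\<close> means that the o-minimal dimension of \<open>X \<inter> R\<^sup>n\<close> is at least \<open>d\<close>.\<close>

primrec rk :: "nat \<Rightarrow> nat \<Rightarrow> 'a list set \<Rightarrow> bool" where
  "rk 0 = (\<lambda>d X. d = 0 \<and> [] \<in> X)"
| "rk (Suc n) = (\<lambda>d X. (\<exists>t. rk n d {x. t # x \<in> X}) \<or>
     (0 < d \<and> infinite {t. rk n (d - 1) {x. t # x \<in> X}}))"

lemma rk_mono: "rk n d X \<Longrightarrow> X \<subseteq> Y \<Longrightarrow> rk n d Y"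
proof (induction n arbitrary: d X Y)
  case (Suc n)
  have step: "rk n e {x. t # x \<in> X} \<Longrightarrow> rk n e {x. t # x \<in> Y}" for e t
    by (rule Suc.IH) (use Suc.prems(2) in auto)
  then have "{t. rk n (d - 1) {x. t # x \<in> X}} \<subseteq> {t. rk n (d - 1) {x. t # x \<in> Y}}" by blast
  then show ?case using Suc.prems(1) step infinite_super unfolding rk.simps by blast
qed auto

lemma rk_SucD:
  assumes "rk (Suc n) d X" shows "\<exists>t e. rk n e {x. t # x \<in> X} \<and> d \<le> Suc e"
proof -
  consider t where "rk n d {x. t # x \<in> X}" | "infinite {t. rk n (d - 1) {x. t # x \<in> X}}"
    using assms by auto
  then show ?thesis
  proof cases
    case 2
    then obtain t where "rk n (d - 1) {x. t # x \<in> X}" using infinite_imp_nonempty by blast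
    then show ?thesis by (intro exI[of _ t] exI[of _ "d - 1"]) simp
  qed (use le_SucI in blast)
qed

lemma rk_le: "rk n d X \<Longrightarrow> d \<le> n"
proof (induction n arbitrary: d X)
  case (Suc n)
  from rk_SucD[OF Suc.prems] obtain t e where "rk n e {x. t # x \<in> X}" "d \<le> Suc e" by blast
  then show ?case using Suc.IH by fastforce
qed simp

lemma rk_nonempty: "rk n d X \<Longrightarrow> \<exists>x\<in>X. length x = n"
proof (induction n arbitrary: d X)
  case (Suc n)
  from rk_SucD[OF Suc.prems] obtain t e where "rk n e {x. t # x \<in> X}" by blast
  from Suc.IH[OF this] show ?case by force
qed simp

lemma rk_zero: "x \<in> X \<Longrightarrow> rk (length x) 0 X"
proof (induction x arbitrary: X)
  case (Cons t x)
  then show ?case using Cons.IH[of "{x. t # x \<in> X}"] by (auto intro: exI[of _ t])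
qed simp

lemma rk_finite: "rk n d X \<Longrightarrow> finite {x \<in> X. length x = n} \<Longrightarrow> d = 0"
proof (induction n arbitrary: d X)
  case (Suc n)
  let ?S = "{x \<in> X. length x = Suc n}"
  have "finite {x \<in> {x. t # x \<in> X}. length x = n}" for t
    by (rule finite_surj[OF Suc.prems(2), of _ tl]) (force intro: image_eqI[of _ _ "t # _"])
  then have zero: "e = 0" if "rk n e {x. t # x \<in> X}" for e t
    using Suc.IH that by blast
  have "t \<in> hd ` ?S" if "rk n e {x. t # x \<in> X}" for e t
    using rk_nonempty[OF that] by force
  then have "{t. rk n (d - 1) {x. t # x \<in> X}} \<subseteq> hd ` ?S" by blast
  then have "finite {t. rk n (d - 1) {x. t # x \<in> X}}"
    using Suc.prems(2) finite_subset by blast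
  then show ?case using Suc.prems(1) zero by auto
qed simp

text \<open>Either some fibre is infinite and induction applies, or all fibres are finite and
  infinitely many of them are nonempty.\<close>

lemma rk_infinite: "infinite X \<Longrightarrow> (\<And>x. x \<in> X \<Longrightarrow> length x = n) \<Longrightarrow> rk n 1 X"
proof (induction n arbitrary: X)
  case 0
  then have "X \<subseteq> {[]}" by auto
  then show ?case using 0 finite_subset by blast
next
  case (Suc n)
  show ?case
  proof (cases "\<exists>t. infinite {x. t # x \<in> X}")
    case True
    then obtain t where "infinite {x. t # x \<in> X}" by blast
    then have "rk n 1 {x. t # x \<in> X}" by (rule Suc.IH) (use Suc.prems(2) in force)
    then show ?thesis by auto
  next
    case False
    have sub: "X \<subseteq> (\<Union>t\<in>{t. rk n 0 {x. t # x \<in> X}}. (#) t ` {x. t # x \<in> X})"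
    proof
      fix y assume "y \<in> X"
      moreover from Suc.prems(2)[OF this] obtain t x where "y = t # x" "length x = n"
        by (auto simp: length_Suc_conv)
      ultimately show "y \<in> (\<Union>t\<in>{t. rk n 0 {x. t # x \<in> X}}. (#) t ` {x. t # x \<in> X})"
        using rk_zero[of x "{x. t # x \<in> X}"] by auto
    qed
    have "infinite {t. rk n 0 {x. t # x \<in> X}}"
    proof
      assume "finite {t. rk n 0 {x. t # x \<in> X}}"
      then have "finite (\<Union>t\<in>{t. rk n 0 {x. t # x \<in> X}}. (#) t ` {x. t # x \<in> X})"
        using False by blast
      then show False using sub Suc.prems(1) finite_subset by blast
    qed
    then show ?thesis by simp
  qed
qed

lemma rk_append:
  assumes "rk m d X" "rk n e Y" shows "rk (m + n) (d + e) {x @ y |x y. x \<in> X \<and> y \<in> Y}"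
  using assms(1)
proof (induction m arbitrary: d X)
  case 0
  then show ?case using assms(2) by (auto elim!: rk_mono intro: exI[of _ "[]"])
next
  case (Suc m)
  have step: "rk (m + n) (c + e) {z. t # z \<in> {x @ y |x y. x \<in> X \<and> y \<in> Y}}"
    if "rk m c {x. t # x \<in> X}" for c t
    by (rule rk_mono[OF Suc.IH[OF that]]) (auto, metis append_Cons)
  consider t where "rk m d {x. t # x \<in> X}" | "0 < d" "infinite {t. rk m (d - 1) {x. t # x \<in> X}}"
    using Suc.prems by auto
  then show ?case
  proof cases
    case (1 t)
    then show ?thesis using step[of d t] by auto
  next
    case 2
    have "{t. rk m (d - 1) {x. t # x \<in> X}}
        \<subseteq> {t. rk (m + n) (d + e - 1) {z. t # z \<in> {x @ y |x y. x \<in> X \<and> y \<in> Y}}}"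
      using step[of "d - 1"] 2(1) by (auto simp del: mem_Collect_eq(1) simp: mem_Collect_eq)
    then show ?thesis using 2 infinite_super by auto
  qed
qed

text \<open>The coordinates of \<open>z\<close> come first, so the recursion of \<open>rk\<close>
  uses them up before it reaches \<open>x\<close>; what is left is a finite set, of rank
  \<open>0\<close>.\<close>

lemma rk_finite_fibres:
  assumes "rk (k + m) d G" "\<And>z. length z = k \<Longrightarrow> finite {x. length x = m \<and> z @ x \<in> G}"
  shows "rk k d {z. length z = k \<and> (\<exists>x. length x = m \<and> z @ x \<in> G)}"
  using assms
proof (induction k arbitrary: d G)
  case 0
  have "{x \<in> G. length x = m} = {x. length x = m \<and> [] @ x \<in> G}" by auto
  then have "finite {x \<in> G. length x = m}" using 0(2)[of "[]"] by simp
  then have "d = 0" using 0(1) rk_finite by simp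
  then show ?case using rk_nonempty[of m d G] 0(1) by auto
next
  case (Suc k)
  have step: "rk k e {z. t # z \<in> {z. length z = Suc k \<and> (\<exists>x. length x = m \<and> z @ x \<in> G)}}"
    if "rk (k + m) e {x. t # x \<in> G}" for e t
  proof -
    have "rk k e {z. length z = k \<and> (\<exists>x. length x = m \<and> z @ x \<in> {x. t # x \<in> G})}"
      by (rule Suc.IH[OF that]) (use Suc.prems(2)[of "t # _"] in simp)
    then show ?thesis by simp
  qed
  have "{t. rk (k + m) (d - 1) {x. t # x \<in> G}}
      \<subseteq> {t. rk k (d - 1) {z. t # z \<in> {z. length z = Suc k \<and> (\<exists>x. length x = m \<and> z @ x \<in> G)}}}"
    using step by blast
  then show ?case using Suc.prems(1) step infinite_super unfolding add_Suc rk.simps by blast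
qed

section \<open>Definability of the rank, and rank under projections\<close>

context o_minimal_field
begin

text \<open>The recursion of \<open>rk\<close> quantifies only by existence and by being infinite,
  and both preserve definability.\<close>

lemma dfn_rk:
  assumes "dfn (\<lambda>\<rho>. map \<rho> [0..<n] \<in> F (\<lambda>i. \<rho> (i + n)))"
  shows "dfn (\<lambda>\<rho>. rk n d (F \<rho>))"
  using assms
proof (induction n arbitrary: d F)
  case 0
  then show ?case by (auto intro: dfn_conj dfn_const)
next
  case (Suc n)
  have "dfn (\<lambda>\<rho>. rk n e {x. \<rho> 0 # x \<in> F (\<lambda>i. \<rho> (Suc i))})" for e
    by (rule Suc.IH) (use dfn_rotate[OF Suc.prems] in simp)
  then show ?case
    unfolding rk.simps by (intro dfn_disj dfn_ex dfn_conj dfn_const dfn_infinite)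
qed

text \<open>The rank of \<open>X\<close> reads the forgotten coordinate \<open>z\<close> before the
  next coordinate \<open>t\<close>, while the rank of the projection reads \<open>t\<close> first
  and the induction hypothesis brings in \<open>z\<close> afterwards. Changing the order is
  elementary unless both coordinates contribute a dimension; in that case
  \<open>infinite_fibres_swap\<close> does it.\<close>

lemma rk_project_one:
  assumes "dset (Suc m) X" "rk m d {x. \<exists>z. z # x \<in> X}" shows "rk (Suc m) d X"
  using assms
proof (induction m arbitrary: d X)
  case 0
  then show ?case by simp
next
  case (Suc m)
  define A where "A e z t \<longleftrightarrow> rk m e {x. z # t # x \<in> X}" for e z t
  have fibre: "(\<exists>z. A e z t) \<or> (0 < e \<and> infinite {z. A (e - 1) z t})"
    if "rk m e {x. \<exists>z. z # t # x \<in> X}" for e t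
  proof -
    define Y where "Y = {z # x |z x. z # t # x \<in> X}"
    have "dfn (\<lambda>\<rho>. \<rho> 0 # t # map (\<lambda>i. \<rho> (Suc i)) [0..<m] \<in> X)"
      by (intro dfn_mem[OF Suc.prems(1)] dv_Cons dt_var dt_const dv_vars)
    moreover have "map \<rho> [0..<Suc m] = \<rho> 0 # map (\<lambda>i. \<rho> (Suc i)) [0..<m]" for \<rho> :: "nat \<Rightarrow> 'a"
      by (simp add: map_upt_Suc del: upt_Suc)
    ultimately have "dset (Suc m) Y" by (simp add: dset_def Y_def del: upt_Suc)
    moreover have "rk m e {x. \<exists>z. z # x \<in> Y}" using that by (simp add: Y_def)
    ultimately have "rk (Suc m) e Y" by (rule Suc.IH)
    then show ?thesis by (simp add: Y_def A_def)
  qed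
  have dA: "dfn (\<lambda>\<rho>. A e (\<rho> 1) (\<rho> 0))" for e
    unfolding A_def
    by (intro dfn_rk) (simp, intro dfn_mem[OF Suc.prems(1)] dv_Cons dt_var dv_point)
  \<comment> \<open>The recursion of \<open>rk\<close> unfolded once: these are the \<open>z\<close>
    over which the fibre of \<open>X\<close> has rank at least \<open>d - 1\<close>.\<close>
  define Z where "Z = {z. (\<exists>t. A (d - 1) z t) \<or> (0 < d - 1 \<and> infinite {t. A (d - 1 - 1) z t})}"
  have goal: "rk (Suc (Suc m)) d X \<longleftrightarrow>
      (\<exists>z t. A d z t) \<or> (0 < d \<and> (\<exists>z. infinite {t. A (d - 1) z t})) \<or> (0 < d \<and> infinite Z)"
    by (auto simp: A_def Z_def)
  \<comment> \<open>Pigeonhole: infinitely many \<open>t\<close> occur over some \<open>z\<close>,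
    or infinitely many \<open>z\<close> occur.\<close>
  have one: "(\<exists>z. infinite {t. A e z t}) \<or> infinite {z. \<exists>t. A e z t}"
    if "infinite {t. \<exists>z. A e z t}" for e
  proof (rule ccontr)
    assume "\<not> ?thesis"
    then have "finite (\<Union>z\<in>{z. \<exists>t. A e z t}. {t. A e z t})" by blast
    moreover have "{t. \<exists>z. A e z t} \<subseteq> (\<Union>z\<in>{z. \<exists>t. A e z t}. {t. A e z t})" by blast
    ultimately show False using that finite_subset by blast
  qed
  consider t where "rk m d {x. \<exists>z. z # t # x \<in> X}"
    | "0 < d" "infinite {t. rk m (d - 1) {x. \<exists>z. z # t # x \<in> X}}"
    using Suc.prems(2) by auto
  then show ?case
  proof cases
    case 1
    from fibre[OF 1] show ?thesis
    proof
      assume *: "0 < d \<and> infinite {z. A (d - 1) z t}"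
      then have "infinite Z" by (intro infinite_super[of "{z. A (d - 1) z t}" Z]) (auto simp: Z_def)
      then show ?thesis unfolding goal using * by simp
    next
      assume "\<exists>z. A d z t"
      then show ?thesis unfolding goal by (elim exE) (intro disjI1 exI)
    qed
  next
    case 2
    have "{t. rk m (d - 1) {x. \<exists>z. z # t # x \<in> X}}
        \<subseteq> {t. \<exists>z. A (d - 1) z t} \<union> {t. 0 < d - 1 \<and> infinite {z. A (d - 1 - 1) z t}}"
      using fibre by blast
    then have "infinite {t. \<exists>z. A (d - 1) z t} \<or> infinite {t. 0 < d - 1 \<and> infinite {z. A (d - 1 - 1) z t}}"
      using 2(2) by (meson finite_UnI finite_subset)
    then show ?thesis
    proof
      assume "infinite {t. \<exists>z. A (d - 1) z t}"
      from one[OF this] show ?thesis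
      proof
        assume "infinite {z. \<exists>t. A (d - 1) z t}"
        then have "infinite Z" by (rule infinite_super[rotated]) (auto simp: Z_def)
        then show ?thesis unfolding goal using 2(1) by simp
      next
        assume "\<exists>z. infinite {t. A (d - 1) z t}"
        then show ?thesis unfolding goal using 2(1) by simp
      qed
    next
      assume *: "infinite {t. 0 < d - 1 \<and> infinite {z. A (d - 1 - 1) z t}}"
      then have "0 < d - 1" by (rule contrapos_np) simp
      then have "infinite {t. infinite {z. A (d - 1 - 1) z t}}" using * by simp
      then have "infinite {z. infinite {t. A (d - 1 - 1) z t}}"
        by (intro infinite_fibres_swap[where S = "\<lambda>t z. A (d - 1 - 1) z t"] dA)
      then have "infinite Z"
        by (rule infinite_super[rotated]) (use \<open>0 < d - 1\<close> in \<open>auto simp: Z_def\<close>)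
      then show ?thesis unfolding goal using 2(1) by simp
    qed
  qed
qed

lemma rk_project:
  assumes "dset (k + m) G" "rk m d {x. \<exists>z. length z = k \<and> z @ x \<in> G}" shows "rk (k + m) d G"
  using assms
proof (induction k arbitrary: G)
  case (Suc k)
  have "dfn (\<lambda>\<rho>. \<exists>z. z # map \<rho> [0..<k + m] \<in> G)"
    using Suc.prems(1) by (intro dfn_ex dfn_mem[of "Suc (k + m)"] dv_Cons dt_var dv_vars) simp
  then have "dset (k + m) {w. \<exists>z. z # w \<in> G}" by (simp add: dset_def)
  moreover have "{x. \<exists>z. length z = k \<and> z @ x \<in> {w. \<exists>z. z # w \<in> G}}
      = {x. \<exists>z. length z = Suc k \<and> z @ x \<in> G}"
    by (auto simp: length_Suc_conv) (metis append_Cons, blast)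
  ultimately have "rk (k + m) d {w. \<exists>z. z # w \<in> G}"
    using Suc.IH Suc.prems(2) by simp
  then show ?case using rk_project_one[of "k + m" G d] Suc.prems(1) by simp
qed simp

text \<open>In the graph of \<open>Q\<close>, written with \<open>z\<close> first, forgetting
  \<open>z\<close> gives at least \<open>A\<close> times \<open>B\<close>, so
  \<open>rk_project\<close> bounds the rank of the graph from below. The fibres over
  \<open>z\<close> are finite, so \<open>rk_finite_fibres\<close> hands this rank on to
  \<open>D\<close>.\<close>

lemma rk_finite_to_one:
  assumes Q: "\<And>z u v. dv k z \<Longrightarrow> dv k u \<Longrightarrow> dv k v \<Longrightarrow> dfn (\<lambda>\<rho>. Q (z \<rho>) (u \<rho>) (v \<rho>))"
    and len: "\<And>x. x \<in> A \<union> B \<union> D \<Longrightarrow> length x = k"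
    and ex: "\<And>u v. u \<in> A \<Longrightarrow> v \<in> B \<Longrightarrow> \<exists>z\<in>D. Q z u v"
    and D: "\<And>z u v. Q z u v \<Longrightarrow> z \<in> D"
    and fin: "\<And>z. finite {(u, v). Q z u v}"
    and rk: "rk k d A" "rk k e B"
  shows "rk k (d + e) D"
proof -
  define G where "G = {w. Q (take k w) (take k (drop k w)) (drop k (drop k w))}"
  have "dset (k + (k + k)) G"
    unfolding G_def
    by (intro dset_Collect Q dv_take[of "k + (k + k)"] dv_take[of "k + k"] dv_drop dv_point) auto
  moreover have "rk (k + k) (d + e) {x. \<exists>z. length z = k \<and> z @ x \<in> G}"
    by (rule rk_mono[OF rk_append[OF rk]]) (use ex len in \<open>fastforce simp: G_def\<close>)
  ultimately have "rk (k + (k + k)) (d + e) G" by (rule rk_project)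
  moreover have "finite {x. length x = k + k \<and> z @ x \<in> G}" if "length z = k" for z
  proof (rule finite_surj[OF fin[of z], of _ "\<lambda>(u, v). u @ v"], rule subsetI)
    fix x assume "x \<in> {x. length x = k + k \<and> z @ x \<in> G}"
    then show "x \<in> (\<lambda>(u, v). u @ v) ` {(u, v). Q z u v}"
      using that by (intro image_eqI[of _ _ "(take k x, drop k x)"]) (auto simp: G_def)
  qed
  ultimately have "rk k (d + e) {z. length z = k \<and> (\<exists>x. length x = k + k \<and> z @ x \<in> G)}"
    by (rule rk_finite_fibres)
  then show ?thesis by (rule rk_mono) (auto simp: G_def D)
qed

end


section \<open>Definable Boolean algebras are finite\<close>

text \<open>Boolean laws in the form that counting needs: \<open>join_diff_inj\<close> embeds
  \<open>[\<bottom>, y]\<close> times \<open>[\<bottom>, x - y]\<close> into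
  \<open>[\<bottom>, x]\<close>, \<open>diff_inj\<close> is injectivity of the relative complement,
  and \<open>below_join\<close> is distributivity. Definability is asked of \<open>B\<close> and
  \<open>le\<close>, from which \<open>join\<close> is recovered as a least upper bound.\<close>

locale boolean_set = o_minimal_field L R
  for L :: "('f, 'p) fo_lang" and R :: "('f, 'p, 'a::real_closed_field) fo_struct" +
  fixes k :: nat and B :: "'a list set" and le :: "'a list \<Rightarrow> 'a list \<Rightarrow> bool"
    and one :: "'a list" and join diff :: "'a list \<Rightarrow> 'a list \<Rightarrow> 'a list"
  assumes length_B: "x \<in> B \<Longrightarrow> length x = k"
    and dfn_B: "dv k p \<Longrightarrow> dfn (\<lambda>\<rho>. p \<rho> \<in> B)"
    and dfn_rel: "dv k p \<Longrightarrow> dv k q \<Longrightarrow> dfn (\<lambda>\<rho>. le (p \<rho>) (q \<rho>))"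
    and refl: "x \<in> B \<Longrightarrow> le x x"
    and trans: "x \<in> B \<Longrightarrow> y \<in> B \<Longrightarrow> z \<in> B \<Longrightarrow> le x y \<Longrightarrow> le y z \<Longrightarrow> le x z"
    and antisym: "x \<in> B \<Longrightarrow> y \<in> B \<Longrightarrow> le x y \<Longrightarrow> le y x \<Longrightarrow> x = y"
    and one: "one \<in> B" "x \<in> B \<Longrightarrow> le x one"
    and join: "x \<in> B \<Longrightarrow> y \<in> B \<Longrightarrow> join x y \<in> B"
    and join_upper: "x \<in> B \<Longrightarrow> y \<in> B \<Longrightarrow> le x (join x y)" "x \<in> B \<Longrightarrow> y \<in> B \<Longrightarrow> le y (join x y)"
    and join_least: "x \<in> B \<Longrightarrow> y \<in> B \<Longrightarrow> z \<in> B \<Longrightarrow> le x z \<Longrightarrow> le y z \<Longrightarrow> le (join x y) z"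
    and below_join: "x \<in> B \<Longrightarrow> y \<in> B \<Longrightarrow> w \<in> B \<Longrightarrow> le w (join x y) \<Longrightarrow>
      \<exists>x'\<in>B. \<exists>y'\<in>B. le x' x \<and> le y' y \<and> w = join x' y'"
    and diff: "x \<in> B \<Longrightarrow> y \<in> B \<Longrightarrow> diff x y \<in> B" "x \<in> B \<Longrightarrow> y \<in> B \<Longrightarrow> le (diff x y) x"
    and diff_inj: "x \<in> B \<Longrightarrow> y \<in> B \<Longrightarrow> y' \<in> B \<Longrightarrow> le y x \<Longrightarrow> le y' x \<Longrightarrow> diff x y = diff x y' \<Longrightarrow> y = y'"
    and join_diff_inj: "x \<in> B \<Longrightarrow> y \<in> B \<Longrightarrow> u \<in> B \<Longrightarrow> v \<in> B \<Longrightarrow> u' \<in> B \<Longrightarrow> v' \<in> B \<Longrightarrow>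
      le u y \<Longrightarrow> le u' y \<Longrightarrow> le v (diff x y) \<Longrightarrow> le v' (diff x y) \<Longrightarrow>
      join u v = join u' v' \<Longrightarrow> u = u' \<and> v = v'"
begin

definition down :: "'a list \<Rightarrow> 'a list set" where
  "down x = {y \<in> B. le y x}"

lemma dfn_down: "dv k u \<Longrightarrow> dv k v \<Longrightarrow> dfn (\<lambda>\<rho>. u \<rho> \<in> down (v \<rho>))"
  unfolding down_def mem_Collect_eq by (intro dfn_conj dfn_B dfn_rel)

text \<open>This form makes finiteness accessible to \<open>dfn_rk\<close>, and hence definable in
  \<open>x\<close>.\<close>

lemma finite_down_iff: "finite (down x) \<longleftrightarrow> \<not> rk k 1 (down x)"
proof
  assume "finite (down x)"
  then show "\<not> rk k 1 (down x)" using rk_finite[of k 1 "down x"] by auto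
next
  assume "\<not> rk k 1 (down x)"
  then show "finite (down x)"
    using rk_infinite[of "down x" k] length_B by (auto simp: down_def)
qed

lemma dfn_finite_down:
  assumes "dv k u" shows "dfn (\<lambda>\<rho>. finite (down (u \<rho>)))"
  unfolding finite_down_iff by (intro dfn_not dfn_rk dfn_down dv_point dv_reindex[OF assms])

lemma rk_join:
  assumes X: "X \<subseteq> B" "\<And>u. dv k u \<Longrightarrow> dfn (\<lambda>\<rho>. u \<rho> \<in> X)"
    and Y: "Y \<subseteq> B" "\<And>u. dv k u \<Longrightarrow> dfn (\<lambda>\<rho>. u \<rho> \<in> Y)"
    and D: "D \<subseteq> B" "\<And>x y. x \<in> X \<Longrightarrow> y \<in> Y \<Longrightarrow> join x y \<in> D"
    and fin: "\<And>z. z \<in> D \<Longrightarrow> finite {(x, y). x \<in> X \<and> y \<in> Y \<and> join x y = z}"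
    and rk: "rk k d X" "rk k e Y"
  shows "rk k (d + e) D"
proof -
  \<comment> \<open>The graph of \<open>join\<close>, spelled out as a least upper bound so as to be
    definable. The explicit length condition fits \<open>dfn_all_vec\<close>.\<close>
  define Q where "Q z x y \<longleftrightarrow> x \<in> X \<and> y \<in> Y \<and> z \<in> B \<and> le x z \<and> le y z \<and>
    (\<forall>w. length w = k \<longrightarrow> w \<in> B \<longrightarrow> le x w \<longrightarrow> le y w \<longrightarrow> le z w)" for z x y
  have Q: "Q z x y \<longleftrightarrow> x \<in> X \<and> y \<in> Y \<and> join x y = z" for z x y
  proof
    assume "Q z x y"
    then have xy: "x \<in> X" "y \<in> Y" "x \<in> B" "y \<in> B" "z \<in> B" "le x z" "le y z"
      and least: "\<And>w. w \<in> B \<Longrightarrow> le x w \<Longrightarrow> le y w \<Longrightarrow> le z w"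
      using X(1) Y(1) length_B unfolding Q_def by blast+
    have "join x y = z"
      by (intro antisym join least join_upper join_least xy)
    then show "x \<in> X \<and> y \<in> Y \<and> join x y = z" using xy by blast
  next
    assume "x \<in> X \<and> y \<in> Y \<and> join x y = z"
    moreover from this have "x \<in> B" "y \<in> B" using X(1) Y(1) by blast+
    ultimately show "Q z x y" unfolding Q_def using join join_upper join_least by blast
  qed
  show ?thesis
  proof (rule rk_finite_to_one[where Q = Q, OF _ _ _ _ _ rk])
    fix z x y assume d: "dv k z" "dv k x" "dv k y"
    show "dfn (\<lambda>\<rho>. Q (z \<rho>) (x \<rho>) (y \<rho>))"
      unfolding Q_def
      by (intro dfn_conj dfn_imp X(2) Y(2) dfn_B dfn_rel dfn_all_vec dv_point d
          dv_reindex[OF d(1)] dv_reindex[OF d(2)] dv_reindex[OF d(3)])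
  next
    fix z
    show "finite {(x, y). Q z x y}"
    proof (cases "z \<in> D")
      case True
      then show ?thesis using fin unfolding Q by blast
    next
      case False
      then have "{(x, y). Q z x y} = {}" unfolding Q using D(2) by blast
      then show ?thesis by simp
    qed
  qed (use X(1) Y(1) D length_B in \<open>auto simp: Q\<close>)
qed

theorem finite_B: "finite B"
proof (rule ccontr)
  assume "infinite B"
  have len: "length y = k" if "y \<in> down x" for x y using that by (simp add: down_def length_B)
  have sub: "down x \<subseteq> B" for x by (auto simp: down_def)
  define r where "r x = (GREATEST d. rk k d (down x))" for x
  have rk_r: "rk k (r x) (down x)" and r_max: "\<And>d. rk k d (down x) \<Longrightarrow> d \<le> r x" if "x \<in> B" for x
  proof -
    have "rk k 0 (down x)"
      using rk_zero[of x "down x"] that by (simp add: down_def refl length_B)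
    then show "rk k (r x) (down x)"
      unfolding r_def by (rule GreatestI_nat) (auto intro: rk_le)
    show "d \<le> r x" if "rk k d (down x)" for d
      unfolding r_def using that by (rule Greatest_le_nat) (auto intro: rk_le)
  qed
  define P where "P x \<longleftrightarrow> x \<in> B \<and> infinite (down x)" for x
  have "down one = B" using one by (auto simp: down_def)
  then have "P one" using \<open>infinite B\<close> one by (simp add: P_def)
  then obtain x where "P x" and min: "\<And>y. P y \<Longrightarrow> r x \<le> r y"
    using ex_has_least_nat[of P one r] by blast
  then have x: "x \<in> B" "infinite (down x)" by (auto simp: P_def)
  have "r x \<ge> 1" using r_max[OF x(1)] x(2) finite_down_iff by blast
  have split: "finite (down y) \<or> finite (down (diff x y))" if "y \<in> down x" for y
  proof (rule ccontr)
    assume *: "\<not> ?thesis"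
    have y: "y \<in> B" "le y x" using that by (auto simp: down_def)
    let ?w = "diff x y"
    have w: "?w \<in> B" "le ?w x" using diff x(1) y(1) by blast+
    \<comment> \<open>The join map has fibres of at most one element here. Minimality of
      \<open>r x\<close> would then give \<open>r x + r x \<le> r x\<close>, against
      \<open>r x \<ge> 1\<close>.\<close>
    have "rk k (r y + r ?w) (down x)"
    proof (rule rk_join[OF sub dfn_down[OF _ dv_const] sub dfn_down[OF _ dv_const] sub _ _
          rk_r[OF y(1)] rk_r[OF w(1)]])
      fix u v assume "u \<in> down y" "v \<in> down ?w"
      then show "join u v \<in> down x"
        using y w x(1) trans[of u y x] trans[of v ?w x] join join_least by (auto simp: down_def)
    next
      fix z
      have "{(u, v). u \<in> down y \<and> v \<in> down ?w \<and> join u v = z} \<subseteq> {p}"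
        if "p \<in> {(u, v). u \<in> down y \<and> v \<in> down ?w \<and> join u v = z}" for p
        using that join_diff_inj[OF x(1) y(1)] by (fastforce simp: down_def)
      then show "finite {(u, v). u \<in> down y \<and> v \<in> down ?w \<and> join u v = z}"
        by (metis (no_types, lifting) finite.simps finite_subset ex_in_conv)
    qed (simp_all add: length_B y w)
    then have "r y + r ?w \<le> r x" by (rule r_max[OF x(1)])
    moreover have "r x \<le> r y" "r x \<le> r ?w" using min * y w by (auto simp: P_def)
    ultimately show False using \<open>r x \<ge> 1\<close> by simp
  qed
  define F where "F = {y \<in> down x. finite (down y)}"
  have dF: "dfn (\<lambda>\<rho>. u \<rho> \<in> F)" if "dv k u" for u
    unfolding F_def mem_Collect_eq using x(1) that
    by (intro dfn_conj dfn_down dfn_finite_down dv_const) (auto simp: length_B)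
  \<comment> \<open>By \<open>split\<close>, the relative complement sends the part of
    \<open>down x\<close> outside \<open>F\<close> into \<open>F\<close>, and it does so
    injectively; a finite \<open>F\<close> would make \<open>down x\<close> finite.\<close>
  have "infinite F"
  proof
    assume fin: "finite F"
    have "diff x ` (down x - F) \<subseteq> F"
      using split diff[OF x(1)] by (auto simp: F_def down_def)
    moreover have "inj_on (diff x) (down x - F)"
      using diff_inj[OF x(1)] by (auto simp: inj_on_def down_def)
    ultimately have "finite (down x - F)" using fin by (meson finite_imageD finite_subset)
    then show False using fin x(2) by simp
  qed
  have joinF: "join u v \<in> F" if "u \<in> F" "v \<in> F" for u v
  proof -
    have uv: "u \<in> B" "v \<in> B" "le u x" "le v x" "finite (down u)" "finite (down v)"
      using that by (auto simp: F_def down_def)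
    \<comment> \<open>Distributivity: an element below a join is the join of a part below
      \<open>u\<close> and a part below \<open>v\<close>, so there are finitely many.\<close>
    have "down (join u v) \<subseteq> (\<lambda>(s, t). join s t) ` (down u \<times> down v)"
      using below_join[OF uv(1,2)] by (fastforce simp: down_def)
    then have "finite (down (join u v))"
      using uv(5,6) by (meson finite_SigmaI finite_imageI finite_subset)
    then show ?thesis using uv x(1) join join_least by (auto simp: F_def down_def)
  qed
  have double: "rk k (d + d) F" if "rk k d F" for d
  proof (rule rk_join[OF _ dF _ dF _ joinF _ that that])
    fix z assume "z \<in> F"
    \<comment> \<open>Both components of a pair with join \<open>z\<close> lie below
      \<open>z\<close>, and \<open>z \<in> F\<close> has finitely many elements below it.\<close>
    have "{(u, v). u \<in> F \<and> v \<in> F \<and> join u v = z} \<subseteq> down z \<times> down z"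
      using join_upper by (auto simp: F_def down_def)
    then show "finite {(u, v). u \<in> F \<and> v \<in> F \<and> join u v = z}"
      using \<open>z \<in> F\<close> by (auto simp: F_def intro: finite_subset)
  qed (auto simp: F_def down_def)
  \<comment> \<open>Starting from rank \<open>1\<close>, doubling is iterated until it passes the
    bound \<open>k\<close> on all ranks.\<close>
  have "rk k (2 ^ n) F" for n
  proof (induction n)
    case 0
    have "rk k 1 F" using \<open>infinite F\<close> len by (intro rk_infinite) (auto simp: F_def)
    then show ?case by simp
  next
    case (Suc n)
    then show ?case using double[of "2 ^ n"] by (simp add: mult_2)
  qed
  from rk_le[OF this[of k]] show False using less_exp[of k] by simp
qed

end


section \<open>Regular elements of pseudocomplemented semilattices\<close>

text \<open>The setting of the theorem of Glivenko and Frink that the regular elements form a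
  Boolean algebra; here it is the common core of the two presentations of Heyting algebras.\<close>

locale pseudocomplemented_semilattice =
  fixes C :: "'b set" and le :: "'b \<Rightarrow> 'b \<Rightarrow> bool" and bot :: 'b
    and meet :: "'b \<Rightarrow> 'b \<Rightarrow> 'b" and neg :: "'b \<Rightarrow> 'b"
  assumes refl: "x \<in> C \<Longrightarrow> le x x"
    and trans: "x \<in> C \<Longrightarrow> y \<in> C \<Longrightarrow> z \<in> C \<Longrightarrow> le x y \<Longrightarrow> le y z \<Longrightarrow> le x z"
    and antisym: "x \<in> C \<Longrightarrow> y \<in> C \<Longrightarrow> le x y \<Longrightarrow> le y x \<Longrightarrow> x = y"
    and bot: "bot \<in> C" "x \<in> C \<Longrightarrow> le bot x"
    and meet: "x \<in> C \<Longrightarrow> y \<in> C \<Longrightarrow> meet x y \<in> C"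
      "x \<in> C \<Longrightarrow> y \<in> C \<Longrightarrow> le (meet x y) x" "x \<in> C \<Longrightarrow> y \<in> C \<Longrightarrow> le (meet x y) y"
      "x \<in> C \<Longrightarrow> y \<in> C \<Longrightarrow> z \<in> C \<Longrightarrow> le z x \<Longrightarrow> le z y \<Longrightarrow> le z (meet x y)"
    and neg: "x \<in> C \<Longrightarrow> neg x \<in> C"
    and le_neg: "x \<in> C \<Longrightarrow> z \<in> C \<Longrightarrow> le z (neg x) \<longleftrightarrow> meet z x = bot"
begin

lemma le_meet_iff:
  assumes "x \<in> C" "y \<in> C" "z \<in> C" shows "le z (meet x y) \<longleftrightarrow> le z x \<and> le z y"
  using meet(1-3)[OF assms(1,2)] meet(4)[OF assms] trans[of z "meet x y"] assms by blast

lemma le_bot: "x \<in> C \<Longrightarrow> le x bot \<Longrightarrow> x = bot"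
  by (simp add: antisym bot)

text \<open>Describes \<open>neg x\<close> by the order and \<open>bot\<close> alone. This makes
  \<open>neg\<close> definable, and it turns inequalities into disjointness statements about
  elements \<open>t\<close>.\<close>

lemma le_neg_iff:
  assumes "x \<in> C" "z \<in> C"
  shows "le z (neg x) \<longleftrightarrow> (\<forall>t\<in>C. le t z \<longrightarrow> le t x \<longrightarrow> t = bot)"
proof
  assume "le z (neg x)"
  then have "meet z x = bot" using assms le_neg by blast
  then show "\<forall>t\<in>C. le t z \<longrightarrow> le t x \<longrightarrow> t = bot"
    using assms meet(4) le_bot by metis
next
  assume "\<forall>t\<in>C. le t z \<longrightarrow> le t x \<longrightarrow> t = bot"
  then show "le z (neg x)" using assms le_neg meet(1-3)[of z x] by simp
qed

lemma le_negI: "x \<in> C \<Longrightarrow> z \<in> C \<Longrightarrow> (\<And>t. t \<in> C \<Longrightarrow> le t z \<Longrightarrow> le t x \<Longrightarrow> t = bot) \<Longrightarrow> le z (neg x)"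
  by (simp add: le_neg_iff)

lemma disjoint_neg: "x \<in> C \<Longrightarrow> t \<in> C \<Longrightarrow> le t (neg x) \<Longrightarrow> le t x \<Longrightarrow> t = bot"
  using le_neg_iff[of x "neg x"] neg refl by blast

lemma neg_antimono: "x \<in> C \<Longrightarrow> y \<in> C \<Longrightarrow> le x y \<Longrightarrow> le (neg y) (neg x)"
proof (rule le_negI)
  fix t assume "x \<in> C" "y \<in> C" "le x y" "t \<in> C" "le t (neg y)" "le t x"
  then show "t = bot" using disjoint_neg[of y t] trans[of t x y] by blast
qed (simp_all add: neg)

lemma le_neg_neg: "x \<in> C \<Longrightarrow> le x (neg (neg x))"
  using le_negI[of "neg x" x] disjoint_neg neg by blast

lemma neg_neg_neg: "x \<in> C \<Longrightarrow> neg (neg (neg x)) = neg x"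
  by (intro antisym neg_antimono le_neg_neg neg)

section \<open>The Boolean operations on regular elements\<close>

definition regular :: "'b set" where
  "regular = {x \<in> C. neg (neg x) = x}"

text \<open>De Morgan's form of the join in the algebra of regular elements; in a Heyting algebra it
  may lie strictly above the ambient join.\<close>

definition join :: "'b \<Rightarrow> 'b \<Rightarrow> 'b" where
  "join x y = neg (meet (neg x) (neg y))"

lemma regularD: "x \<in> regular \<Longrightarrow> x \<in> C" "x \<in> regular \<Longrightarrow> neg (neg x) = x"
  by (simp_all add: regular_def)

lemma neg_regular: "x \<in> C \<Longrightarrow> neg x \<in> regular"
  by (simp add: regular_def neg neg_neg_neg)

text \<open>Being below \<open>x = neg (neg x)\<close> means being disjoint from
  \<open>neg x\<close>, so inequalities with a regular right-hand side can be proved by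
  contradiction.\<close>

lemma le_regularI:
  assumes "x \<in> regular" "z \<in> C" "\<And>t. t \<in> C \<Longrightarrow> le t z \<Longrightarrow> le t (neg x) \<Longrightarrow> t = bot"
  shows "le z x"
  using le_negI[of "neg x" z] assms regularD[OF assms(1)] neg by auto

lemma meet_regular: "x \<in> regular \<Longrightarrow> y \<in> regular \<Longrightarrow> meet x y \<in> regular"
proof -
  assume "x \<in> regular" "y \<in> regular"
  then have xy: "x \<in> C" "y \<in> C" "neg (neg x) = x" "neg (neg y) = y" by (auto simp: regular_def)
  then have m: "meet x y \<in> C" using meet by blast
  have "le (neg (neg (meet x y))) (neg (neg x))" "le (neg (neg (meet x y))) (neg (neg y))"
    by (intro neg_antimono neg m xy(1,2) meet(2,3))+
  then have "le (neg (neg (meet x y))) (meet x y)"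
    using xy m meet(4) neg by simp
  then have "neg (neg (meet x y)) = meet x y" by (intro antisym le_neg_neg neg m)
  then show ?thesis using m by (simp add: regular_def)
qed

lemma join_regular: "x \<in> C \<Longrightarrow> y \<in> C \<Longrightarrow> join x y \<in> regular"
  by (simp add: join_def neg_regular meet neg)

lemma join_commute: "x \<in> C \<Longrightarrow> y \<in> C \<Longrightarrow> join x y = join y x"
  unfolding join_def by (rule arg_cong[where f = neg]) (intro antisym meet neg)

lemma join_upper: "x \<in> regular \<Longrightarrow> y \<in> C \<Longrightarrow> le x (join x y)"
  using neg_antimono[of "meet (neg x) (neg y)" "neg x"] by (simp add: join_def regular_def meet neg)

lemma join_least:
  assumes "x \<in> C" "y \<in> C" "z \<in> regular" "le x z" "le y z" shows "le (join x y) z"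
proof -
  have "le (neg z) (meet (neg x) (neg y))"
    using assms by (intro meet neg neg_antimono) (auto simp: regular_def)
  then have "le (join x y) (neg (neg z))"
    unfolding join_def using assms by (intro neg_antimono meet neg) (auto simp: regular_def)
  then show ?thesis using assms(3) by (simp add: regular_def)
qed

text \<open>Stands in for distributivity: an element disjoint from \<open>x\<close> and from
  \<open>y\<close> lies below \<open>meet (neg x) (neg y)\<close>, and \<open>join x y\<close> is
  the negation of that.\<close>

lemma le_join_disjoint:
  assumes xy: "x \<in> C" "y \<in> C" and t: "t \<in> C" "le t (join x y)"
    and dis: "\<And>s. s \<in> C \<Longrightarrow> le s t \<Longrightarrow> le s x \<Longrightarrow> s = bot" "\<And>s. s \<in> C \<Longrightarrow> le s t \<Longrightarrow> le s y \<Longrightarrow> s = bot"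
  shows "t = bot"
proof (rule disjoint_neg)
  show "le t (neg (meet (neg x) (neg y)))" using t(2) by (simp add: join_def)
  show "le t (meet (neg x) (neg y))"
    using le_negI[OF xy(1) t(1) dis(1)] le_negI[OF xy(2) t(1) dis(2)] xy t(1)
    by (simp add: le_meet_iff neg)
qed (use xy t(1) in \<open>simp_all add: meet neg\<close>)

text \<open>A remainder \<open>t\<close> of \<open>w\<close> disjoint from the right-hand side is
  disjoint from \<open>x\<close> and from \<open>y\<close>, hence is \<open>bot\<close> by
  \<open>le_join_disjoint\<close>.\<close>

lemma below_join:
  assumes x: "x \<in> regular" and y: "y \<in> regular" and w: "w \<in> regular" and le: "le w (join x y)"
  shows "w = join (meet w x) (meet w y)"
proof (rule antisym)
  have C: "x \<in> C" "y \<in> C" "w \<in> C" "meet w x \<in> C" "meet w y \<in> C"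
    using x y w by (auto simp: regularD meet)
  then show "w \<in> C" "join (meet w x) (meet w y) \<in> C"
    using join_regular regularD by blast+
  show "le (join (meet w x) (meet w y)) w"
    using C w by (intro join_least) (auto simp: meet)
  show "le w (join (meet w x) (meet w y))"
  proof (rule le_regularI)
    show "join (meet w x) (meet w y) \<in> regular" using C join_regular by blast
    fix t assume t: "t \<in> C" "le t w" "le t (neg (join (meet w x) (meet w y)))"
    have j: "join (meet w x) (meet w y) \<in> C" by fact
    have jx: "le (meet w x) (join (meet w x) (meet w y))"
      using C x w join_upper meet_regular by blast
    have jy: "le (meet w y) (join (meet w x) (meet w y))"
      using C y w join_upper[of "meet w y" "meet w x"] meet_regular join_commute by metis
    show "t = bot"
    proof (rule le_join_disjoint[OF C(1,2)])
      show "le t (join x y)" using trans[OF t(1) C(3) _ t(2) le] C join_regular regularD by blast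
    next
      fix s assume s: "s \<in> C" "le s t" "le s x"
      then have "le s (meet w x)" using C t trans meet(4) by blast
      then have "le s (join (meet w x) (meet w y))" using s C j jx trans by blast
      moreover have "le s (neg (join (meet w x) (meet w y)))" using s t j neg trans by blast
      ultimately show "s = bot" using disjoint_neg j s by blast
    next
      fix s assume s: "s \<in> C" "le s t" "le s y"
      then have "le s (meet w y)" using C t trans meet(4) by blast
      then have "le s (join (meet w x) (meet w y))" using s C j jy trans by blast
      moreover have "le s (neg (join (meet w x) (meet w y)))" using s t j neg trans by blast
      ultimately show "s = bot" using disjoint_neg j s by blast
    qed (fact t)
  qed (fact C)
qed

text \<open>Recovers a summand from a join of parts separated by \<open>y\<close>; this is the
  source of \<open>join_diff_inj\<close>.\<close>

lemma meet_join_disjoint: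
  assumes y: "y \<in> C" and u: "u \<in> regular" "le u y" and v: "v \<in> regular" "le v (neg y)"
  shows "meet y (join u v) = u"
proof (rule antisym)
  have C: "u \<in> C" "v \<in> C" using u v by (auto simp: regularD)
  then have j: "join u v \<in> C" using join_regular regularD by blast
  show "u \<in> C" by fact
  show m: "meet y (join u v) \<in> C" using y j meet by blast
  show "le u (meet y (join u v))" using u C y j join_upper[OF u(1) C(2)] by (simp add: le_meet_iff)
  show "le (meet y (join u v)) u"
  proof (rule le_regularI[OF u(1) m])
    fix t assume t: "t \<in> C" "le t (meet y (join u v))" "le t (neg u)"
    have ty: "le t y" "le t (join u v)" using t j y by (simp_all add: le_meet_iff)
    show "t = bot"
    proof (rule le_join_disjoint[OF C t(1) ty(2)])
      fix s assume s: "s \<in> C" "le s t" "le s u"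
      have "le s (neg u)" by (rule trans[OF s(1) t(1) neg[OF C(1)] s(2) t(3)])
      then show "s = bot" by (rule disjoint_neg[OF C(1) s(1) _ s(3)])
    next
      fix s assume s: "s \<in> C" "le s t" "le s v"
      have "le s (neg y)" by (rule trans[OF s(1) C(2) neg[OF y] s(3) v(2)])
      moreover have "le s y" by (rule trans[OF s(1) t(1) y s(2) ty(1)])
      ultimately show "s = bot" by (rule disjoint_neg[OF y s(1)])
    qed
  qed
qed

text \<open>An involution is injective, which yields \<open>diff_inj\<close>.\<close>

lemma diff_diff:
  assumes x: "x \<in> regular" and y: "y \<in> regular" and le: "le y x"
  shows "meet x (neg (meet x (neg y))) = y"
proof (rule antisym)
  have C: "x \<in> C" "y \<in> C" "neg y \<in> C" "meet x (neg y) \<in> C" "neg (meet x (neg y)) \<in> C"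
    using x y by (auto simp: regularD neg meet)
  show m: "meet x (neg (meet x (neg y))) \<in> C" and "y \<in> C" using C meet by blast+
  have "le y (neg (meet x (neg y)))"
  proof (rule le_negI)
    fix t assume t: "t \<in> C" "le t y" "le t (meet x (neg y))"
    then have "le t (neg y)" using C by (simp add: le_meet_iff)
    then show "t = bot" by (rule disjoint_neg[OF C(2) t(1) _ t(2)])
  qed (fact C)+
  then show "le y (meet x (neg (meet x (neg y))))" using C le by (simp add: le_meet_iff)
  show "le (meet x (neg (meet x (neg y)))) y"
  proof (rule le_regularI[OF y m])
    fix t assume t: "t \<in> C" "le t (meet x (neg (meet x (neg y))))" "le t (neg y)"
    have "le t x" "le t (neg (meet x (neg y)))" using t C by (simp_all add: le_meet_iff)
    then show "t = bot" using disjoint_neg[OF C(4) t(1)] t C by (simp add: le_meet_iff)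
  qed
qed

end

context o_minimal_field
begin

lemma finite_regular:
  fixes le :: "'a list \<Rightarrow> 'a list \<Rightarrow> bool" and meet :: "'a list \<Rightarrow> 'a list \<Rightarrow> 'a list"
    and bot :: "'a list"
  assumes "pseudocomplemented_semilattice C le bot meet neg"
    and length_C: "\<And>x. x \<in> C \<Longrightarrow> length x = k"
    and dC: "\<And>u. dv k u \<Longrightarrow> dfn (\<lambda>\<rho>. u \<rho> \<in> C)"
    and dle: "\<And>u v. dv k u \<Longrightarrow> dv k v \<Longrightarrow> dfn (\<lambda>\<rho>. le (u \<rho>) (v \<rho>))"
  shows "finite {x \<in> C. neg (neg x) = x}"
proof -
  interpret pseudocomplemented_semilattice C le bot meet neg by fact
  \<comment> \<open>The graph of \<open>neg\<close> written in terms of the order, following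
    \<open>le_neg_iff\<close>, with quantifiers over vectors of length \<open>k\<close>.\<close>
  define N where "N y x \<longleftrightarrow> y \<in> C \<and> (\<forall>z. length z = k \<longrightarrow> z \<in> C \<longrightarrow>
    (le z y \<longleftrightarrow> (\<forall>t. length t = k \<longrightarrow> t \<in> C \<longrightarrow> le t z \<longrightarrow> le t x \<longrightarrow> t = bot)))" for y x
  have vec: "(\<forall>z. length z = k \<longrightarrow> z \<in> C \<longrightarrow> P z) \<longleftrightarrow> (\<forall>z\<in>C. P z)" for P
    using length_C by blast
  have N: "N y x \<longleftrightarrow> y = neg x" if x: "x \<in> C" for x y
  proof -
    have "N y x \<longleftrightarrow> y \<in> C \<and> (\<forall>z\<in>C. le z y \<longleftrightarrow> le z (neg x))"
      unfolding N_def vec using le_neg_iff[OF x] by simp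
    moreover have "y = neg x" if "y \<in> C" "\<forall>z\<in>C. le z y \<longleftrightarrow> le z (neg x)"
      using that neg[OF x] refl[of y] refl[of "neg x"] by (intro antisym) blast+
    ultimately show ?thesis using neg[OF x] by blast
  qed
  have dN: "dfn (\<lambda>\<rho>. N (u \<rho>) (v \<rho>))" if "dv k u" "dv k v" for u v
    unfolding N_def
    by (intro dfn_conj dfn_imp dfn_iff dC dle dfn_all_vec dfn_vec_eq[of k] dv_point dv_const that
        length_C bot dv_reindex[OF that(1)] dv_reindex[OF that(2)] dv_vars)
  \<comment> \<open>An element is regular when it and some \<open>y\<close> are each the
    pseudocomplement of the other; this form is visibly definable.\<close>
  have regular_iff: "x \<in> regular \<longleftrightarrow> x \<in> C \<and> (\<exists>y. length y = k \<and> y \<in> C \<and> N y x \<and> N x y)" for x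
  proof
    assume "x \<in> regular"
    then have "x \<in> C" "neg (neg x) = x" by (simp_all add: regular_def)
    then show "x \<in> C \<and> (\<exists>y. length y = k \<and> y \<in> C \<and> N y x \<and> N x y)"
      by (intro conjI exI[of _ "neg x"]) (simp_all add: N neg length_C)
  next
    assume "x \<in> C \<and> (\<exists>y. length y = k \<and> y \<in> C \<and> N y x \<and> N x y)"
    then obtain y where "x \<in> C" "y \<in> C" "N y x" "N x y" by blast
    then have "y = neg x" "neg y = x" using N[of x y] N[of y x] by simp_all
    then show "x \<in> regular" using \<open>x \<in> C\<close> unfolding regular_def by blast
  qed
  interpret boolean_set L R k regular le "neg bot" join "\<lambda>x y. meet x (neg y)"
  proof
    fix u v assume u: "dv k u"
    then show "dfn (\<lambda>\<rho>. u \<rho> \<in> regular)"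
      unfolding regular_iff
      by (intro dfn_conj dC dfn_ex_vec dN dv_point u dv_reindex[OF u])
    assume "dv k v"
    then show "dfn (\<lambda>\<rho>. le (u \<rho>) (v \<rho>))" using u dle by blast
  next
    fix x y w assume "x \<in> regular" "y \<in> regular" "w \<in> regular" "le w (join x y)"
    then show "\<exists>x'\<in>regular. \<exists>y'\<in>regular. le x' x \<and> le y' y \<and> w = join x' y'"
      using below_join[of x y w] meet_regular[of w x] meet_regular[of w y]
        meet(3)[of w x] meet(3)[of w y] regularD(1) by blast
  next
    fix x y y' assume r: "x \<in> regular" "y \<in> regular" "y' \<in> regular" "le y x" "le y' x"
      and eq: "meet x (neg y) = meet x (neg y')"
    have "y = meet x (neg (meet x (neg y)))" using diff_diff r by simp
    also have "\<dots> = y'" unfolding eq using diff_diff r by simp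
    finally show "y = y'" .
  next
    fix x y u v u' v'
    assume xy: "x \<in> regular" "y \<in> regular" and
      uv: "u \<in> regular" "v \<in> regular" "u' \<in> regular" "v' \<in> regular" "le u y" "le u' y"
      and v: "le v (meet x (neg y))" "le v' (meet x (neg y))" and eq: "join u v = join u' v'"
    have C: "x \<in> C" "y \<in> C" "neg y \<in> C" "u \<in> C" "v \<in> C" "u' \<in> C" "v' \<in> C"
      using xy uv regularD neg by blast+
    have le: "le v (neg y)" "le v' (neg y)" using v C by (simp_all add: le_meet_iff)
    have "u = u'"
      using meet_join_disjoint[of y u v] meet_join_disjoint[of y u' v'] uv le C eq by simp
    \<comment> \<open>The second summand is recovered by the same lemma with \<open>neg y\<close>
      for \<open>y\<close>; regularity of \<open>y\<close> puts \<open>u\<close> below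
      \<open>neg (neg y)\<close>.\<close>
    moreover have "join v u = join v' u'"
      using eq join_commute[of u v] join_commute[of u' v'] C by simp
    then have "v = v'"
      using meet_join_disjoint[of "neg y" v u] meet_join_disjoint[of "neg y" v' u']
        uv le C regularD(2)[OF xy(2)] by simp
    ultimately show "u = u' \<and> v = v'" by blast
  next
    fix x y assume xy: "x \<in> regular" "y \<in> regular"
    show "le y (join x y)" using xy join_upper[of y x] join_commute[of y x] by (simp add: regularD)
    show "meet x (neg y) \<in> regular" using xy by (simp add: meet_regular neg_regular regularD)
    show "le (meet x (neg y)) x" using xy by (simp add: meet neg regularD)
    show "join x y \<in> regular" using xy by (simp add: join_regular regularD)
    show "le x (join x y)" using xy by (simp add: join_upper regularD)
  next
    fix x assume "x \<in> regular"
    then show "le x (neg bot)" using le_negI[of bot x] bot(1) le_bot by (simp add: regularD)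
    show "length x = k" "le x x" using \<open>x \<in> regular\<close> by (simp_all add: regularD length_C refl)
  next
    fix x y z assume "x \<in> regular" "y \<in> regular" "z \<in> regular"
    then have C: "x \<in> C" "y \<in> C" "z \<in> C" by (simp_all add: regularD)
    show "le x y \<Longrightarrow> le y z \<Longrightarrow> le x z" by (rule trans[OF C])
    show "le x z \<Longrightarrow> le y z \<Longrightarrow> le (join x y) z"
      by (rule join_least[OF C(1,2) \<open>z \<in> regular\<close>])
    show "le x y \<Longrightarrow> le y x \<Longrightarrow> x = y" by (rule antisym[OF C(1,2)])
  qed (simp add: neg_regular bot)
  from finite_B show ?thesis by (simp add: regular_def)
qed

end


section \<open>Dimension of finite and of infinite definable sets\<close>

lemma band_fibre_interval:
  fixes l u :: "('b \<Rightarrow> 'a::linordered_field) option"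
  assumes "\<And>f g. l = Some f \<Longrightarrow> u = Some g \<Longrightarrow> f xs < g xs"
  shows "\<exists>a b. a < b \<and>
    {a<..<b} \<subseteq> {y. (\<forall>f. l = Some f \<longrightarrow> f xs < y) \<and> (\<forall>g. u = Some g \<longrightarrow> y < g xs)}"
proof (cases l; cases u)
  assume "l = None" "u = None"
  then show ?thesis by (intro exI[of _ 0] exI[of _ 1]) simp
next
  fix g assume "l = None" "u = Some g"
  then show ?thesis by (intro exI[of _ "g xs - 1"] exI[of _ "g xs"]) auto
next
  fix f assume "l = Some f" "u = None"
  then show ?thesis by (intro exI[of _ "f xs"] exI[of _ "f xs + 1"]) auto
next
  fix f g assume lu: "l = Some f" "u = Some g"
  then show ?thesis using assms[OF lu] by (intro exI[of _ "f xs"] exI[of _ "g xs"]) auto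
qed

lemma cell_nonempty: "cell L R n d C \<Longrightarrow> C \<noteq> {}"
proof (induction rule: cell.induct)
  case (band n d C l u)
  then obtain xs where xs: "xs \<in> C" by blast
  obtain a b where "a < b" and
    "{a<..<b} \<subseteq> {y. (\<forall>f. l = Some f \<longrightarrow> f xs < y) \<and> (\<forall>g. u = Some g \<longrightarrow> y < g xs)}"
    using band_fibre_interval[of l u xs] band.hyps(4)[OF _ _ xs] by blast
  moreover obtain y where "a < y" "y < b" using dense \<open>a < b\<close> by blast
  ultimately have "(\<forall>f. l = Some f \<longrightarrow> f xs < y) \<and> (\<forall>g. u = Some g \<longrightarrow> y < g xs)" by auto
  then show ?case using xs by blast
qed auto

lemma cell_infinite: "cell L R n d C \<Longrightarrow> 0 < d \<Longrightarrow> infinite C"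
proof (induction rule: cell.induct)
  case (graph n d C f)
  have "C \<subseteq> butlast ` {xs @ [f xs] |xs. xs \<in> C}" by (force simp: image_iff)
  then show ?case using graph.IH graph.prems finite_surj by blast
next
  case (band n d C l u)
  obtain xs where xs: "xs \<in> C" using cell_nonempty[OF band.hyps(1)] by blast
  define Y where "Y = {y. (\<forall>f. l = Some f \<longrightarrow> f xs < y) \<and> (\<forall>g. u = Some g \<longrightarrow> y < g xs)}"
  obtain a b where "a < b" "{a<..<b} \<subseteq> Y"
    using band_fibre_interval[of l u xs] band.hyps(4)[OF _ _ xs] unfolding Y_def by blast
  then have "infinite Y" using infinite_Ioo finite_subset by blast
  then have "infinite ((\<lambda>y. xs @ [y]) ` Y)" by (simp add: finite_image_iff inj_on_def)
  then show ?case by (rule infinite_super[rotated]) (use xs in \<open>auto simp: Y_def\<close>)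
qed simp

text \<open>Cells inside a finite set have dimension \<open>0\<close>. Equality can fail, since the
  empty set has dimension \<open>-\<infinity>\<close>.\<close>

lemma o_dim_finite:
  assumes "finite X" shows "o_dim L R n X \<le> 0"
  unfolding o_dim_def
proof (rule Sup_least, clarify)
  fix d C assume "cell L R n d C" "C \<subseteq> X"
  then have "d = 0" using cell_infinite assms finite_subset by blast
  then show "ereal (real d) \<le> 0" by simp
qed

section \<open>Limits and continuity of definable functions of one variable\<close>

context o_minimal_field
begin

text \<open>\<open>l\<close> is the upper limit of \<open>g\<close> at \<open>a\<close> from the
  right. By \<open>germ\<close>, exceeding \<open>l - e\<close> arbitrarily close to
  \<open>a\<close> becomes exceeding it on a whole interval.\<close>

lemma limit_right:
  assumes g: "dt (\<lambda>\<rho>. g (\<rho> 0))" and "a < b" and bound: "\<And>s. a < s \<Longrightarrow> s < b \<Longrightarrow> - m \<le> g s \<and> g s \<le> m"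
    and "e > 0"
  shows "\<exists>l. \<exists>h>a. \<forall>s. a < s \<and> s < h \<longrightarrow> l - e < g s \<and> g s < l + e"
proof -
  define C where "C c \<longleftrightarrow> (\<forall>h>a. \<exists>s>a. s < h \<and> c \<le> g s)" for c
  have dg: "dt t \<Longrightarrow> dt (\<lambda>\<rho>. g (t \<rho>))" for t by (rule dt_compose[OF g])
  have "dfn (\<lambda>\<rho>. C (\<rho> 0))" unfolding C_def by (intro dfn_intros dg)
  moreover have "C (- m)"
    unfolding C_def
  proof clarify
    fix h assume "a < h"
    then obtain s where "a < s" "s < min h b" using dense[of a "min h b"] \<open>a < b\<close> by auto
    then show "\<exists>s>a. s < h \<and> - m \<le> g s" using bound[of s] by auto
  qed
  moreover have "c \<le> m" if c: "C c" for c
  proof -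
    obtain s where "a < s" "s < b" "c \<le> g s" using c \<open>a < b\<close> unfolding C_def by blast
    then show ?thesis using bound[of s] by simp
  qed
  ultimately obtain l where l: "\<forall>c. C c \<longrightarrow> c \<le> l" "\<forall>y<l. \<exists>c. C c \<and> y < c"
    using definable_sup[of C "- m" m] by blast
  have "l - e < l" using \<open>e > 0\<close> by simp
  then obtain c where c: "C c" "l - e < c" using l(2) by blast
  have "dfn (\<lambda>\<rho>. l - e < g (\<rho> 0))" by (intro dfn_intros dg)
  moreover have "\<exists>s. a < s \<and> s < h \<and> l - e < g s" if h: "a < h" for h
  proof -
    obtain s where "a < s" "s < h" "c \<le> g s" using c(1) h unfolding C_def by blast
    then show ?thesis using c(2) by (intro exI[of _ s]) simp
  qed
  ultimately obtain h where h: "h > a" "\<forall>s. a < s \<and> s < h \<longrightarrow> l - e < g s"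
    using germ[of "\<lambda>s. l - e < g s" a] by blast
  have "\<not> C (l + e)" using l(1) \<open>e > 0\<close> by force
  then obtain h' where h': "h' > a" "\<And>s. a < s \<Longrightarrow> s < h' \<Longrightarrow> g s < l + e"
    unfolding C_def by (meson not_le)
  show ?thesis using h h' by (intro exI[of _ l] exI[of _ "min h h'"]) simp
qed

definition cts_at :: "('a \<Rightarrow> 'a) \<Rightarrow> 'a \<Rightarrow> bool" where
  "cts_at g t \<longleftrightarrow> (\<forall>e>0. \<exists>d>0. \<forall>s. t - d < s \<and> s < t + d \<longrightarrow> g t - e < g s \<and> g s < g t + e)"

text \<open>If \<open>g\<close> were discontinuous almost everywhere, it would be bounded and oscillate by a fixed
  amount at every point of some interval, which contradicts the existence of its one-sided limit at
  the left endpoint.\<close>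

lemma cts_on_subinterval:
  assumes g: "dt (\<lambda>\<rho>. g (\<rho> 0))" and "a < b"
  shows "\<exists>a' b'. a' < b' \<and> (\<forall>t. a' < t \<and> t < b' \<longrightarrow> a < t \<and> t < b \<and> cts_at g t)"
proof -
  have dg: "dt t \<Longrightarrow> dt (\<lambda>\<rho>. g (t \<rho>))" for t by (rule dt_compose[OF g])
  have dK: "dfn (\<lambda>\<rho>. a < \<rho> 0 \<and> \<rho> 0 < b \<and> cts_at g (\<rho> 0))"
    unfolding cts_at_def by (intro dfn_intros dg)
  \<comment> \<open>Oscillation by at least \<open>e\<close> at \<open>t\<close>, together with the
    bound \<open>1 / e\<close> on \<open>\<bar>g t\<bar>\<close>. Both weaken as \<open>e\<close>
    shrinks, as \<open>infinite_level\<close> requires.\<close>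
  define U where "U t e \<longleftrightarrow> a < t \<and> t < b \<and> - 1 \<le> g t * e \<and> g t * e \<le> 1 \<and>
    (\<forall>d>0. \<exists>s. t - d < s \<and> s < t + d \<and> \<not> (g t - e < g s \<and> g s < g t + e))" for t e
  have dU: "dfn (\<lambda>\<rho>. U (\<rho> 0) (\<rho> 1))" unfolding U_def by (intro dfn_intros dg)
  have anti: "U t e'" if u: "U t e" "0 < e'" "e' \<le> e" for t e e'
  proof -
    have "\<bar>g t * e'\<bar> \<le> \<bar>g t * e\<bar>" using u by (simp add: abs_mult mult_left_mono)
    moreover have "\<bar>g t * e\<bar> \<le> 1" using u(1) unfolding U_def abs_le_iff by auto
    ultimately have "\<bar>g t * e'\<bar> \<le> 1" by simp
    then have "- 1 \<le> g t * e'" "g t * e' \<le> 1" by (auto simp: abs_le_iff)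
    moreover have "\<exists>s. t - d < s \<and> s < t + d \<and> \<not> (g t - e' < g s \<and> g s < g t + e')"
      if d: "d > 0" for d
    proof -
      obtain s where "t - d < s" "s < t + d" "\<not> (g t - e < g s \<and> g s < g t + e)"
        using u(1) d unfolding U_def by blast
      then show ?thesis using u(3) by (intro exI[of _ s]) auto
    qed
    ultimately show ?thesis using u(1) unfolding U_def by blast
  qed
  have "infinite {t. a < t \<and> t < b \<and> cts_at g t}"
  proof
    assume fin: "finite {t. a < t \<and> t < b \<and> cts_at g t}"
    have "{a<..<b} - {t. a < t \<and> t < b \<and> cts_at g t} \<subseteq> {t. \<exists>e>0. U t e}"
    proof
      fix t assume "t \<in> {a<..<b} - {t. a < t \<and> t < b \<and> cts_at g t}"
      then have t: "a < t" "t < b" "\<not> cts_at g t" by auto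
      then obtain e where e: "e > 0"
        "\<And>d. d > 0 \<Longrightarrow> \<exists>s. t - d < s \<and> s < t + d \<and> \<not> (g t - e < g s \<and> g s < g t + e)"
        unfolding cts_at_def by blast
      define e' where "e' = min e (1 / (1 + \<bar>g t\<bar>))"
      have "e' > 0" using e(1) by (simp add: e'_def add_pos_nonneg)
      have "e' \<le> 1 / (1 + \<bar>g t\<bar>)" unfolding e'_def by (rule min.cobounded2)
      then have "\<bar>g t\<bar> * e' \<le> 1"
        using \<open>e' > 0\<close> by (simp add: le_divide_eq add_pos_nonneg distrib_left) (simp add: mult.commute)
      then have "\<bar>g t * e'\<bar> \<le> 1" using \<open>e' > 0\<close> by (simp add: abs_mult)
      then have "- 1 \<le> g t * e'" "g t * e' \<le> 1" by (auto simp: abs_le_iff)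
      moreover have "\<exists>s. t - d < s \<and> s < t + d \<and> \<not> (g t - e' < g s \<and> g s < g t + e')"
        if d: "d > 0" for d
      proof -
        have "e' \<le> e" unfolding e'_def by (rule min.cobounded1)
        moreover obtain s where "t - d < s" "s < t + d" "\<not> (g t - e < g s \<and> g s < g t + e)"
          using e(2)[OF d] by blast
        ultimately show ?thesis by (intro exI[of _ s]) auto
      qed
      ultimately have "U t e'" using t unfolding U_def by blast
      then show "t \<in> {t. \<exists>e>0. U t e}" using \<open>e' > 0\<close> by blast
    qed
    moreover have "infinite ({a<..<b} - {t. a < t \<and> t < b \<and> cts_at g t})"
      using infinite_Ioo[OF \<open>a < b\<close>] fin by (rule Diff_infinite_finite[rotated])
    ultimately have inf: "infinite {t. \<exists>e>0. U t e}" by (rule infinite_super)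
    have "\<exists>e>0. infinite {t. U t e}"
      by (rule infinite_level) (fact dU, fact anti, fact inf)
    then obtain e where e: "e > 0" "infinite {t. U t e}" by (elim exE conjE)
    have "dfn (\<lambda>\<rho>. U (\<rho> 0) e)" by (intro dfn_subst_term2[OF dU] dfn_intros)
    from infinite_contains_interval[OF this e(2)]
    obtain a' b' where ab: "a' < b'" "\<And>s. a' < s \<Longrightarrow> s < b' \<Longrightarrow> U s e" by blast
    have "- (1 / e) \<le> g s \<and> g s \<le> 1 / e" if "a' < s" "s < b'" for s
    proof -
      have "- 1 \<le> g s * e" "g s * e \<le> 1" using ab(2)[OF that] unfolding U_def by auto
      then show ?thesis using e(1) by (simp add: field_simps)
    qed
    \<comment> \<open>With all values within \<open>e / 2\<close> of \<open>l\<close>, any two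
      differ by less than \<open>e\<close>, so \<open>g\<close> cannot oscillate by \<open>e\<close>
      at a point just right of \<open>a'\<close>.\<close>
    then have "\<exists>l. \<exists>h>a'. \<forall>s. a' < s \<and> s < h \<longrightarrow> l - e / 2 < g s \<and> g s < l + e / 2"
      by (intro limit_right[OF g ab(1)]) (use e(1) in simp_all)
    then obtain l h where h: "h > a'" "\<And>s. a' < s \<Longrightarrow> s < h \<Longrightarrow> l - e / 2 < g s \<and> g s < l + e / 2"
      by blast
    obtain t where t: "a' < t" "t < min h b'" using dense[of a' "min h b'"] h(1) ab(1) by auto
    define d where "d = min (t - a') (h - t)"
    have "d > 0" using t by (simp add: d_def)
    have "U t e" using t ab(2) by simp
    then obtain s where s: "t - d < s" "s < t + d" "\<not> (g t - e < g s \<and> g s < g t + e)"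
      using \<open>d > 0\<close> unfolding U_def by blast
    have "d \<le> t - a'" "d \<le> h - t" unfolding d_def by (rule min.cobounded1 min.cobounded2)+
    then have "a' < s" "s < h" using s(1,2) by (simp_all add: algebra_simps)
    from h(2)[OF this] h(2)[of t] t have "g t - e < g s \<and> g s < g t + e"
      by (auto simp: field_simps)
    then show False using s(3) by blast
  qed
  from infinite_contains_interval[OF dK this] show ?thesis by blast
qed

section \<open>Curves that are cells\<close>

lemma dset_singleton: "length p = n \<Longrightarrow> dset n {p}"
  unfolding dset_def singleton_iff by (intro dfn_vec_eq[of n] dv_point dv_const)

lemma definable_cont_singleton:
  assumes "length p = n" shows "definable_cont L R n {p} (\<lambda>_. c)"
proof -
  have "definable L R (Suc n) {p @ [c]}"
    using assms by (intro dset_imp_definable dset_singleton) auto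
  moreover have "{xs @ [c] |xs. xs \<in> {p}} = {p @ [c]}" by auto
  ultimately show ?thesis
    unfolding definable_cont_def by (auto simp: cont_on_def intro: exI[of _ 1])
qed

lemma cell_singleton: "cell L R (length p) 0 {p}"
proof (induction p rule: rev_induct)
  case (snoc c p)
  have "{xs @ [c] |xs. xs \<in> {p}} = {p @ [c]}" by auto
  then show ?case using cell.graph[OF snoc definable_cont_singleton[of p]] by simp
qed (simp add: cell.point)

text \<open>Induction on the last coordinate, as cells are built. Either some vertical line meets
  \<open>X\<close> in an interval, or all vertical fibres are finite; then a curve in the infinite
  projection is lifted by the least element of each fibre. Two clauses serve the induction: some
  coordinate equals the parameter, so a function of the parameter is a function of the point; and
  every subinterval gives a cell, since continuity of the lift forces the interval to
  shrink.\<close>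

lemma cell_curve:
  assumes "dset n X" "infinite X" "\<And>x. x \<in> X \<Longrightarrow> length x = n"
  shows "\<exists>\<gamma> a b. a < b \<and> dv n (\<lambda>\<rho>. \<gamma> (\<rho> 0)) \<and>
    (\<exists>i<n. \<forall>t. a < t \<and> t < b \<longrightarrow> \<gamma> t ! i = t) \<and> \<gamma> ` {a<..<b} \<subseteq> X \<and>
    (\<forall>a' b'. a' < b' \<longrightarrow> {a'<..<b'} \<subseteq> {a<..<b} \<longrightarrow> cell L R n 1 (\<gamma> ` {a'<..<b'}))"
  using assms
proof (induction n arbitrary: X)
  case 0
  then have "X \<subseteq> {[]}" by auto
  then show ?case using 0(2) finite_subset by blast
next
  case (Suc n)
  show ?case
  proof (cases "\<exists>p. infinite {y. p @ [y] \<in> X}")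
    case True
    then obtain p where p: "infinite {y. p @ [y] \<in> X}" by blast
    then obtain y where "p @ [y] \<in> X" using infinite_imp_nonempty by blast
    then have len: "length p = n" using Suc.prems(3) by force
    have dp: "dv (Suc n) (\<lambda>\<rho>. p @ [\<rho> 0])" using len by (intro dv_snoc dv_const dt_var)
    obtain a b where ab: "a < b" "\<And>y. a < y \<Longrightarrow> y < b \<Longrightarrow> p @ [y] \<in> X"
      using infinite_contains_interval[OF dfn_mem[OF Suc.prems(1) dp] p] by blast
    have "cell L R (Suc n) 1 ((\<lambda>t. p @ [t]) ` {a'<..<b'})" if "a' < b'" for a' b'
    proof -
      have "cell L R n 0 {p}" using cell_singleton[of p] len by simp
      from cell.band[OF this, of "Some (\<lambda>_. a')" "Some (\<lambda>_. b')"]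
      have "cell L R (Suc n) (Suc 0) {xs @ [y] |xs y. xs \<in> {p} \<and>
          (\<forall>f. Some (\<lambda>_. a') = Some f \<longrightarrow> f xs < y) \<and> (\<forall>g. Some (\<lambda>_. b') = Some g \<longrightarrow> y < g xs)}"
        using definable_cont_singleton[OF len] that by auto
      moreover have "{xs @ [y] |xs y. xs \<in> {p} \<and>
          (\<forall>f. Some (\<lambda>_. a') = Some f \<longrightarrow> f xs < y) \<and> (\<forall>g. Some (\<lambda>_. b') = Some g \<longrightarrow> y < g xs)}
        = (\<lambda>t. p @ [t]) ` {a'<..<b'}"
        by auto
      ultimately show ?thesis by simp
    qed
    then show ?thesis
      using ab dp len by (intro exI[of _ "\<lambda>t. p @ [t]"] exI[of _ a] exI[of _ b]) auto
  next
    case False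
    then have fin: "\<And>p. finite {y. p @ [y] \<in> X}" by blast
    define Y where "Y = {p. \<exists>y. p @ [y] \<in> X}"
    have dY: "dset n Y"
      unfolding Y_def dset_def mem_Collect_eq
      by (intro dfn_ex dfn_mem[OF Suc.prems(1)] dv_snoc dv_vars dt_var)
    have iY: "infinite Y"
    proof
      assume "finite Y"
      then have "finite (\<Union>p\<in>Y. (\<lambda>y. p @ [y]) ` {y. p @ [y] \<in> X})" using fin by blast
      moreover have "X \<subseteq> (\<Union>p\<in>Y. (\<lambda>y. p @ [y]) ` {y. p @ [y] \<in> X})"
      proof
        fix x assume x: "x \<in> X"
        obtain p y where "x = p @ [y]" using Suc.prems(3)[OF x] by (cases x rule: rev_cases) auto
        then show "x \<in> (\<Union>p\<in>Y. (\<lambda>y. p @ [y]) ` {y. p @ [y] \<in> X})"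
          using x unfolding Y_def by blast
      qed
      ultimately show False using Suc.prems(2) finite_subset by blast
    qed
    have lY: "length p = n" if "p \<in> Y" for p
      using that Suc.prems(3) unfolding Y_def by force
    have "\<exists>\<gamma> a b. a < b \<and> dv n (\<lambda>\<rho>. \<gamma> (\<rho> 0)) \<and>
        (\<exists>i<n. \<forall>t. a < t \<and> t < b \<longrightarrow> \<gamma> t ! i = t) \<and> \<gamma> ` {a<..<b} \<subseteq> Y \<and>
        (\<forall>a' b'. a' < b' \<longrightarrow> {a'<..<b'} \<subseteq> {a<..<b} \<longrightarrow> cell L R n 1 (\<gamma> ` {a'<..<b'}))"
      by (rule Suc.IH) (fact dY, fact iY, fact lY)
    then obtain \<gamma> a b where IH: "a < b \<and> dv n (\<lambda>\<rho>. \<gamma> (\<rho> 0)) \<and>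
        (\<exists>i<n. \<forall>t. a < t \<and> t < b \<longrightarrow> \<gamma> t ! i = t) \<and> \<gamma> ` {a<..<b} \<subseteq> Y \<and>
        (\<forall>a' b'. a' < b' \<longrightarrow> {a'<..<b'} \<subseteq> {a<..<b} \<longrightarrow> cell L R n 1 (\<gamma> ` {a'<..<b'}))"
      by (elim exE)
    then have ab: "a < b" and \<gamma>: "dv n (\<lambda>\<rho>. \<gamma> (\<rho> 0))" and sub: "\<gamma> ` {a<..<b} \<subseteq> Y"
      and cell: "\<And>a' b'. a' < b' \<Longrightarrow> {a'<..<b'} \<subseteq> {a<..<b} \<Longrightarrow> cell L R n 1 (\<gamma> ` {a'<..<b'})"
      by simp_all
    from IH obtain i where i: "i < n" "\<And>t. a < t \<Longrightarrow> t < b \<Longrightarrow> \<gamma> t ! i = t" by auto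
    define F where "F t y \<longleftrightarrow> \<gamma> t @ [y] \<in> X" for t y
    \<comment> \<open>The least lift. The default \<open>0\<close> outside the interval makes
      \<open>g\<close> a total definable function.\<close>
    define g where "g t = (if a < t \<and> t < b then Min {y. F t y} else 0)" for t
    have F: "finite {y. F t y}" "a < t \<Longrightarrow> t < b \<Longrightarrow> {y. F t y} \<noteq> {}" for t
      using fin subsetD[OF sub, of "\<gamma> t"] unfolding F_def Y_def by simp_all
    have g_iff: "y = g t \<longleftrightarrow> (a < t \<and> t < b \<and> F t y \<and> (\<forall>z. F t z \<longrightarrow> y \<le> z)) \<or>
        (\<not> (a < t \<and> t < b) \<and> y = 0)" for t y
    proof (cases "a < t \<and> t < b")
      case True
      then have "y = g t \<longleftrightarrow> F t y \<and> (\<forall>z. F t z \<longrightarrow> y \<le> z)"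
        using Min_eq_iff[OF F(1) F(2)[of t], of y] by (subst eq_commute) (simp add: g_def)
      then show ?thesis using True by blast
    next
      case False
      then have "g t = 0" unfolding g_def by (rule if_not_P)
      then show ?thesis using False by metis
    qed
    have dF: "dfn (\<lambda>\<rho>. F (\<rho> m) (\<rho> n))" for m n
      unfolding F_def using dv_reindex[OF \<gamma>, of "\<lambda>_. m"]
      by (intro dfn_mem[OF Suc.prems(1)] dv_snoc dt_var)
    have dg: "dt (\<lambda>\<rho>. g (\<rho> 0))"
      unfolding dt_def g_iff by (intro dfn_intros dF)
    obtain c d where cd: "c < d" "\<And>t. c < t \<Longrightarrow> t < d \<Longrightarrow> a < t \<and> t < b \<and> cts_at g t"
      using cts_on_subinterval[OF dg ab] by blast
    have d\<gamma>: "dv (Suc n) (\<lambda>\<rho>. \<gamma> (\<rho> 0) @ [g (\<rho> 0)])" by (intro dv_snoc \<gamma> dg)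
    have len: "length (\<gamma> t) = n" for t using dv_length[OF \<gamma>, of "\<lambda>_. t"] .
    have "cell L R (Suc n) 1 ((\<lambda>t. \<gamma> t @ [g t]) ` {a'<..<b'})"
      if ab': "a' < b'" "{a'<..<b'} \<subseteq> {c<..<d}" for a' b'
    proof -
      have in_ab: "a < t" "t < b" "cts_at g t" if "t \<in> {a'<..<b'}" for t
        using that ab'(2) cd(2) by auto
      \<comment> \<open>As a function of the point, \<open>g\<close> reads the parameter off
        coordinate \<open>i\<close>.\<close>
      have eq: "{xs @ [g (xs ! i)] |xs. xs \<in> \<gamma> ` {a'<..<b'}} = (\<lambda>t. \<gamma> t @ [g t]) ` {a'<..<b'}"
        using in_ab i(2) by (force simp: image_iff)
      have "dfn (\<lambda>\<rho>. \<exists>t. a' < t \<and> t < b' \<and> map \<rho> [0..<Suc n] = \<gamma> t @ [g t])"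
        by (intro dfn_intros dfn_vec_eq[OF dv_vars d\<gamma>])
      moreover have "v \<in> (\<lambda>t. \<gamma> t @ [g t]) ` {a'<..<b'} \<longleftrightarrow>
          (\<exists>t. a' < t \<and> t < b' \<and> v = \<gamma> t @ [g t])" for v
        by auto
      ultimately have "dset (Suc n) ((\<lambda>t. \<gamma> t @ [g t]) ` {a'<..<b'})"
        unfolding dset_def by simp
      then have "definable L R (Suc n) ((\<lambda>t. \<gamma> t @ [g t]) ` {a'<..<b'})"
        by (rule dset_imp_definable) (auto simp: len)
      \<comment> \<open>Points close in coordinate \<open>i\<close> have close parameters, so
        continuity of \<open>g\<close> at the parameter \<open>t\<close> carries over.\<close>
      moreover have "cont_on (\<gamma> ` {a'<..<b'}) (\<lambda>xs. g (xs ! i))"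
        unfolding cont_on_def
      proof clarify
        fix t \<epsilon> :: 'a assume t: "t \<in> {a'<..<b'}" and "\<epsilon> > 0"
        then obtain \<delta> where \<delta>: "\<delta> > 0"
          "\<And>s. t - \<delta> < s \<Longrightarrow> s < t + \<delta> \<Longrightarrow> g t - \<epsilon> < g s \<and> g s < g t + \<epsilon>"
          using in_ab(3)[OF t] unfolding cts_at_def by blast
        have "\<bar>g (ys ! i) - g (\<gamma> t ! i)\<bar> < \<epsilon>"
          if ys: "ys \<in> \<gamma> ` {a'<..<b'}" "\<forall>j<length (\<gamma> t). \<bar>ys ! j - \<gamma> t ! j\<bar> < \<delta>" for ys
        proof -
          obtain s where s: "s \<in> {a'<..<b'}" "ys = \<gamma> s" using ys(1) by blast
          have "ys ! i = s" "\<gamma> t ! i = t" using in_ab i(2) s t by auto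
          moreover from this have "\<bar>s - t\<bar> < \<delta>" using ys(2) i(1) len by metis
          then have "t - \<delta> < s" "s < t + \<delta>" by (auto simp: abs_less_iff algebra_simps)
          from \<delta>(2)[OF this] have "\<bar>g s - g t\<bar> < \<epsilon>" by (auto simp: abs_less_iff algebra_simps)
          ultimately show ?thesis by simp
        qed
        then show "\<exists>\<delta>>0. \<forall>ys\<in>\<gamma> ` {a'<..<b'}.
            (\<forall>i<length (\<gamma> t). \<bar>ys ! i - \<gamma> t ! i\<bar> < \<delta>) \<longrightarrow> \<bar>g (ys ! i) - g (\<gamma> t ! i)\<bar> < \<epsilon>"
          using \<delta>(1) by blast
      qed
      ultimately have "definable_cont L R n (\<gamma> ` {a'<..<b'}) (\<lambda>xs. g (xs ! i))"
        unfolding definable_cont_def eq by blast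
      moreover have "{a'<..<b'} \<subseteq> {a<..<b}" using in_ab by auto
      ultimately have "cell L R (Suc n) 1 {xs @ [g (xs ! i)] |xs. xs \<in> \<gamma> ` {a'<..<b'}}"
        using cell ab'(1) by (intro cell.graph)
      then show ?thesis unfolding eq .
    qed
    moreover have "\<gamma> t @ [g t] \<in> X" if "c < t" "t < d" for t
      using g_iff[of "g t" t] cd(2)[OF that] unfolding F_def by blast
    moreover have "(\<gamma> t @ [g t]) ! i = t" if "c < t" "t < d" for t
      using i cd(2)[OF that] len by (simp add: nth_append)
    ultimately show ?thesis
      using cd(1) d\<gamma> i(1)
      by (intro exI[of _ "\<lambda>t. \<gamma> t @ [g t]"] exI[of _ c] exI[of _ d]) (auto intro!: exI[of _ i])
  qed
qed

lemma o_dim_infinite: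
  assumes "definable L R n X" "infinite X" shows "1 \<le> o_dim L R n X"
proof -
  have "\<exists>\<gamma> a b. a < b \<and> dv n (\<lambda>\<rho>. \<gamma> (\<rho> 0)) \<and>
    (\<exists>i<n. \<forall>t. a < t \<and> t < b \<longrightarrow> \<gamma> t ! i = t) \<and> \<gamma> ` {a<..<b} \<subseteq> X \<and>
    (\<forall>a' b'. a' < b' \<longrightarrow> {a'<..<b'} \<subseteq> {a<..<b} \<longrightarrow> cell L R n 1 (\<gamma> ` {a'<..<b'}))"
    using definable_length[OF assms(1)]
    by (intro cell_curve definable_imp_dset assms)
  then obtain C where "cell L R n 1 C" "C \<subseteq> X"
    by (elim exE conjE) (meson order_refl)
  then have "ereal (real 1) \<in> {ereal (real d) |d. \<exists>C. cell L R n d C \<and> C \<subseteq> X}"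
    by blast
  then have "ereal (real 1) \<le> o_dim L R n X"
    unfolding o_dim_def by (rule Sup_upper)
  then show ?thesis by (simp add: one_ereal_def)
qed

lemma o_dim_finite_less:
  assumes "definable L R n X" "infinite X" "finite Y" shows "o_dim L R n Y < o_dim L R n X"
proof -
  have "o_dim L R n Y < 1" using o_dim_finite[OF assms(3), of L R n] by (rule le_less_trans) simp
  then show ?thesis using o_dim_infinite[OF assms(1,2)] by (rule less_le_trans)
qed

end

context o_minimal_field
begin

lemma solutions_dim:
  fixes le :: "'a list \<Rightarrow> 'a list \<Rightarrow> bool" and meet :: "'a list \<Rightarrow> 'a list \<Rightarrow> 'a list"
    and bot :: "'a list"
  assumes semilattice: "pseudocomplemented_semilattice C le bot meet neg"
    and C: "definable L R k C" "infinite C"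
    and le: "definable L R (2 * k) {x @ y |x y. x \<in> C \<and> y \<in> C \<and> le x y}"
    and S: "S \<subseteq> {x \<in> C. neg (neg x) = x}"
  shows "o_dim L R k S < o_dim L R k C"
proof -
  \<comment> \<open>The hypothesis speaks of the order on \<open>C\<close> only, while
    \<open>finite_regular\<close> wants a relation definable on all vectors of length
    \<open>k\<close>.\<close>
  define le' where "le' x y \<longleftrightarrow> x \<in> C \<and> y \<in> C \<and> le x y" for x y
  have len: "length x = k" if "x \<in> C" for x using definable_length[OF C(1) that] .
  interpret pseudocomplemented_semilattice C le bot meet neg by fact
  have "pseudocomplemented_semilattice C le' bot meet neg"
    by unfold_locales (auto simp: le'_def refl bot meet neg le_neg intro: trans antisym)
  moreover have "dfn (\<lambda>\<rho>. le' (u \<rho>) (v \<rho>))" if uv: "dv k u" "dv k v" for u v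
  proof -
    have "le' (u \<rho>) (v \<rho>) \<longleftrightarrow> u \<rho> @ v \<rho> \<in> {x @ y |x y. x \<in> C \<and> y \<in> C \<and> le x y}" for \<rho>
      using dv_length[OF uv(1)] len by (auto simp: le'_def)
    moreover have "dfn (\<lambda>\<rho>. u \<rho> @ v \<rho> \<in> {x @ y |x y. x \<in> C \<and> y \<in> C \<and> le x y})"
      using le dv_append[OF uv] by (intro dfn_mem[of "2 * k"] definable_imp_dset) (simp_all add: mult_2)
    ultimately show ?thesis by simp
  qed
  ultimately have "finite {x \<in> C. neg (neg x) = x}"
    by (intro finite_regular[of C le' bot meet neg k] dfn_mem[OF definable_imp_dset[OF C(1)]] len)
  then show ?thesis using o_dim_finite_less[OF C] S finite_subset by blast
qed

end


section \<open>Heyting algebras\<close>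

lemma tuples_1: "tuples 1 U = (\<lambda>x. [x]) ` U"
  by (auto simp: tuples_def length_Suc_conv)

lemma tuples_2: "tuples 2 U = (\<lambda>(x, y). [x, y]) ` (U \<times> U)"
  by (auto simp: tuples_def numeral_2_eq_2 length_Suc_conv)

lemma pseudocomplemented_semilatticeI:
  fixes le :: "'b \<Rightarrow> 'b \<Rightarrow> bool" and meet :: "'b \<Rightarrow> 'b \<Rightarrow> 'b" and bot :: 'b
  assumes refl: "\<And>x. x \<in> C \<Longrightarrow> le x x"
    and trans: "\<And>x y z. x \<in> C \<Longrightarrow> y \<in> C \<Longrightarrow> z \<in> C \<Longrightarrow> le x y \<Longrightarrow> le y z \<Longrightarrow> le x z"
    and antisym: "\<And>x y. x \<in> C \<Longrightarrow> y \<in> C \<Longrightarrow> le x y \<Longrightarrow> le y x \<Longrightarrow> x = y"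
    and bot: "bot \<in> C" "\<And>x. x \<in> C \<Longrightarrow> le bot x"
    and meet: "\<And>x y. x \<in> C \<Longrightarrow> y \<in> C \<Longrightarrow> meet x y \<in> C"
      "\<And>x y. x \<in> C \<Longrightarrow> y \<in> C \<Longrightarrow> le (meet x y) x" "\<And>x y. x \<in> C \<Longrightarrow> y \<in> C \<Longrightarrow> le (meet x y) y"
      "\<And>x y z. x \<in> C \<Longrightarrow> y \<in> C \<Longrightarrow> z \<in> C \<Longrightarrow> le z x \<Longrightarrow> le z y \<Longrightarrow> le z (meet x y)"
    and neg: "\<And>x. x \<in> C \<Longrightarrow> neg x \<in> C"
      "\<And>x. x \<in> C \<Longrightarrow> le (meet x (neg x)) bot"
      "\<And>x z. x \<in> C \<Longrightarrow> z \<in> C \<Longrightarrow> le (meet x z) bot \<Longrightarrow> le z (neg x)"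
  shows "pseudocomplemented_semilattice C le bot meet neg"
proof
  fix x z assume C: "x \<in> C" "z \<in> C"
  show "le z (neg x) \<longleftrightarrow> meet z x = bot"
  proof
    assume z: "le z (neg x)"
    have "le (meet z x) (neg x)" by (rule trans[of _ z]) (use C z meet neg in simp_all)
    then have "le (meet z x) (meet x (neg x))" using C meet neg by simp
    then have "le (meet z x) bot" by (rule trans[rotated 3]) (use C meet neg bot in simp_all)
    then show "meet z x = bot" by (intro antisym meet bot C)
  next
    assume eq: "meet z x = bot"
    have "le (meet x z) (meet z x)" by (intro meet C)
    then show "le z (neg x)" unfolding eq by (intro neg C)
  qed
qed (fact refl trans antisym bot meet neg)+

text \<open>Here \<open>sup\<close> is the ambient join. Meeting \<open>neg (neg x)\<close> with
  \<open>sup x (neg x)\<close> and distributing leaves only a part below \<open>x\<close>. This puts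
  the solutions of excluded middle among the regular elements.\<close>

lemma (in pseudocomplemented_semilattice) neg_neg_complemented:
  fixes sup :: "'b \<Rightarrow> 'b \<Rightarrow> 'b"
  assumes x: "x \<in> C" and sup: "\<And>y z. y \<in> C \<Longrightarrow> z \<in> C \<Longrightarrow> sup y z \<in> C"
    and least: "\<And>y z w. y \<in> C \<Longrightarrow> z \<in> C \<Longrightarrow> w \<in> C \<Longrightarrow> le y w \<Longrightarrow> le z w \<Longrightarrow> le (sup y z) w"
    and distrib: "\<And>y. y \<in> C \<Longrightarrow> meet y (sup x (neg x)) = sup (meet y x) (meet y (neg x))"
    and top: "\<And>y. y \<in> C \<Longrightarrow> le y (sup x (neg x))"
  shows "neg (neg x) = x"
proof (rule antisym)
  let ?y = "neg (neg x)"
  show y: "?y \<in> C" and "x \<in> C" using x neg by simp_all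
  have "le ?y (meet ?y (sup x (neg x)))" using y x neg sup refl top by (simp add: le_meet_iff)
  then have le: "le ?y (sup (meet ?y x) (meet ?y (neg x)))" using distrib[OF y] by simp
  have "meet ?y (neg x) = bot" using le_neg[of "neg x" ?y] y x neg refl by simp
  then have "le (meet ?y (neg x)) x" using bot x by simp
  then have "le (sup (meet ?y x) (meet ?y (neg x))) x" using x y neg meet by (intro least) simp_all
  then show "le ?y x" using le by (intro trans[of ?y _ x]) (simp_all add: x y neg meet sup)
  show "le x ?y" using x by (rule le_neg_neg)
qed

lemma pseudocomplemented_models:
  assumes str: "is_structure heyting_lang M" and mod: "models M heyting_theory"
  defines "b \<equiv> fun_int M HBot []" and "m \<equiv> \<lambda>x y. fun_int M HMeet [x, y]"
    and "n \<equiv> \<lambda>x. fun_int M HImp [x, fun_int M HBot []]"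
  shows "pseudocomplemented_semilattice (univ M) (\<lambda>x y. rel_int M HLe [x, y]) b m n"
    and "x \<in> univ M \<Longrightarrow> fun_int M HJoin [x, n x] = fun_int M HTop [] \<Longrightarrow> n (n x) = x"
proof -
  let ?U = "univ M"
  define le where "le x y \<longleftrightarrow> rel_int M HLe [x, y]" for x y
  define j where "j x y = fun_int M HJoin [x, y]" for x y
  define i where "i x y = fun_int M HImp [x, y]" for x y
  define t where "t = fun_int M HTop []"
  obtain c where "c \<in> ?U" using str by (auto simp: is_structure_def)
  \<comment> \<open>The axioms are sentences, so a single constant assignment carries all their
    content.\<close>
  then have sat: "\<forall>\<psi>\<in>heyting_theory. sat M (\<lambda>_. c) \<psi>" using mod by (auto simp: models_def)
  have ops: "fun_int M HBot [] = b" "fun_int M HTop [] = t" "fun_int M HMeet [x, y] = m x y"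
    "fun_int M HJoin [x, y] = j x y" "fun_int M HImp [x, y] = i x y" "rel_int M HLe [x, y] = le x y" for x y
    by (simp_all add: b_def t_def m_def j_def i_def le_def)
  note axioms = sat[unfolded heyting_theory_def Let_def, simplified, unfolded ops]
  have closed: "fun_int M f xs \<in> ?U" if "fun_arity heyting_lang f = Some (length xs)" "set xs \<subseteq> ?U" for f xs
    using str that unfolding is_structure_def tuples_def by blast
  have cl: "b \<in> ?U" "\<And>x y. x \<in> ?U \<Longrightarrow> y \<in> ?U \<Longrightarrow> m x y \<in> ?U"
    "\<And>x y. x \<in> ?U \<Longrightarrow> y \<in> ?U \<Longrightarrow> j x y \<in> ?U" "\<And>x y. x \<in> ?U \<Longrightarrow> y \<in> ?U \<Longrightarrow> i x y \<in> ?U"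
    unfolding b_def m_def j_def i_def by (simp_all add: closed heyting_lang_def)
  have n: "n x = i x b" for x by (simp add: n_def i_def b_def)
  from axioms have
    refl: "\<forall>x\<in>?U. le x x" and
    antisym: "\<forall>x\<in>?U. \<forall>y\<in>?U. le y x \<longrightarrow> le x y \<longrightarrow> x = y" and
    trans: "\<forall>x\<in>?U. \<forall>y\<in>?U. le x y \<longrightarrow> (\<forall>z\<in>?U. le y z \<longrightarrow> le x z)" and
    bot: "\<forall>x\<in>?U. le b x" and top: "\<forall>x\<in>?U. le x t" and
    meet: "\<forall>x\<in>?U. \<forall>y\<in>?U. le (m x y) x \<and> le (m x y) y"
      "\<forall>x\<in>?U. \<forall>y\<in>?U. \<forall>z\<in>?U. le z x \<longrightarrow> le z y \<longrightarrow> le z (m x y)" and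
    join: "\<forall>x\<in>?U. \<forall>y\<in>?U. \<forall>z\<in>?U. le x z \<longrightarrow> le y z \<longrightarrow> le (j x y) z" and
    distrib: "\<forall>x\<in>?U. \<forall>y\<in>?U. \<forall>z\<in>?U. m x (j y z) = j (m x y) (m x z)" and
    imp: "\<forall>x\<in>?U. \<forall>y\<in>?U. le (m x (i x y)) y"
      "\<forall>x\<in>?U. \<forall>y\<in>?U. \<forall>z\<in>?U. le (m x z) y \<longrightarrow> le z (i x y)"
    by - (elim conjE, assumption)+
  have semilattice: "pseudocomplemented_semilattice ?U le b m n"
  proof (rule pseudocomplemented_semilatticeI)
    show "b \<in> ?U" by (rule cl)
    fix x assume x: "x \<in> ?U"
    show "le x x" "le b x" using refl bot x by blast+
    show "n x \<in> ?U" "le (m x (n x)) b" unfolding n using imp(1) cl x by blast+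
    fix y assume y: "y \<in> ?U"
    show "le x y \<Longrightarrow> le y x \<Longrightarrow> x = y" using antisym x y by blast
    show "m x y \<in> ?U" "le (m x y) x" "le (m x y) y" using meet(1) cl x y by blast+
    show "le (m x y) b \<Longrightarrow> le y (n x)" unfolding n using imp(2) cl(1) x y by blast
    fix z assume z: "z \<in> ?U"
    show "le x y \<Longrightarrow> le y z \<Longrightarrow> le x z" using trans x y z by blast
    show "le z x \<Longrightarrow> le z y \<Longrightarrow> le z (m x y)" using meet(2) x y z by blast
  qed
  then show "pseudocomplemented_semilattice ?U (\<lambda>x y. rel_int M HLe [x, y]) b m n"
    unfolding le_def .
  assume x: "x \<in> ?U" and "fun_int M HJoin [x, n x] = fun_int M HTop []"
  then have jt: "j x (n x) = t" by (simp add: j_def t_def)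
  show "n (n x) = x"
  proof (rule pseudocomplemented_semilattice.neg_neg_complemented[OF semilattice x, where sup = j])
    have "n x \<in> ?U" using cl x by (simp add: n)
    then show "m y (j x (n x)) = j (m y x) (m y (n x))" if "y \<in> ?U" for y
      using distrib x that by blast
  qed (use cl(3) join top jt in simp_all)
qed

lemma pseudocomplemented_order:
  assumes "heyting_algebra H"
  shows "pseudocomplemented_semilattice (carrier H) (\<lambda>x y. x \<sqsubseteq>\<^bsub>H\<^esub> y) \<bottom>\<^bsub>H\<^esub> (\<lambda>x y. x \<sqinter>\<^bsub>H\<^esub> y) (hneg H)"
    and "x \<in> carrier H \<Longrightarrow> x \<squnion>\<^bsub>H\<^esub> hneg H x = \<top>\<^bsub>H\<^esub> \<Longrightarrow> hneg H (hneg H x) = x"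
proof -
  interpret heyting_algebra H by fact
  have "greatest H (hneg H x) {z \<in> carrier H. x \<sqinter>\<^bsub>H\<^esub> z \<sqsubseteq>\<^bsub>H\<^esub> \<bottom>\<^bsub>H\<^esub>}" if "x \<in> carrier H" for x
    unfolding hneg_def himp_def by (rule someI_ex) (rule imp_exists[OF that bottom_closed])
  then have neg: "hneg H x \<in> carrier H" "x \<sqinter>\<^bsub>H\<^esub> hneg H x \<sqsubseteq>\<^bsub>H\<^esub> \<bottom>\<^bsub>H\<^esub>"
    "\<And>z. z \<in> carrier H \<Longrightarrow> x \<sqinter>\<^bsub>H\<^esub> z \<sqsubseteq>\<^bsub>H\<^esub> \<bottom>\<^bsub>H\<^esub> \<Longrightarrow> z \<sqsubseteq>\<^bsub>H\<^esub> hneg H x" if "x \<in> carrier H" for x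
    using that unfolding greatest_def by blast+
  show *: "pseudocomplemented_semilattice (carrier H) (\<lambda>x y. x \<sqsubseteq>\<^bsub>H\<^esub> y) \<bottom>\<^bsub>H\<^esub> (\<lambda>x y. x \<sqinter>\<^bsub>H\<^esub> y) (hneg H)"
    by (rule pseudocomplemented_semilatticeI)
      (auto simp: neg meet_left meet_right intro: meet_le le_trans le_antisym)
  assume x: "x \<in> carrier H" and top: "x \<squnion>\<^bsub>H\<^esub> hneg H x = \<top>\<^bsub>H\<^esub>"
  show "hneg H (hneg H x) = x"
  proof (rule pseudocomplemented_semilattice.neg_neg_complemented[OF * x,
        where sup = "\<lambda>x y. x \<squnion>\<^bsub>H\<^esub> y"])
    fix y assume y: "y \<in> carrier H"
    show "y \<sqinter>\<^bsub>H\<^esub> (x \<squnion>\<^bsub>H\<^esub> hneg H x) = (y \<sqinter>\<^bsub>H\<^esub> x) \<squnion>\<^bsub>H\<^esub> (y \<sqinter>\<^bsub>H\<^esub> hneg H x)"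
      using y x neg(1) by (intro meet_join_distrib)
    show "y \<sqsubseteq>\<^bsub>H\<^esub> x \<squnion>\<^bsub>H\<^esub> hneg H x" unfolding top using y by (rule top_higher)
  qed (auto intro: join_le)
qed

text \<open>The hypothesis \<open>sat\<close> says that every solution of \<open>\<phi>\<close> is
  regular. The strict inequality is then the alternative that always holds, by
  \<open>solutions_dim\<close>.\<close>

lemma dimensional_gap_heyting:
  fixes L :: "('f, 'p) fo_lang" and R :: "('f, 'p, 'a::real_closed_field) fo_struct"
  assumes "o_minimal_field L R" and \<phi>: "formula_in heyting_lang 1 \<phi>"
    and sat: "\<And>(M :: (heyting_fun, heyting_rel, 'a list) fo_struct) e.
      is_structure heyting_lang M \<Longrightarrow> models M heyting_theory \<Longrightarrow> e 0 \<in> univ M \<Longrightarrow> sat M e \<phi> \<Longrightarrow>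
      fun_int M HImp [fun_int M HImp [e 0, fun_int M HBot []], fun_int M HBot []] = e 0"
  shows "dimensional_gap L R heyting_lang heyting_theory 1 \<phi>"
proof -
  interpret o_minimal_field L R by fact
  have "o_dim L R (1 * k) (concat ` solutions M 1 \<phi>) < o_dim L R (1 * k) (concat ` tuples 1 (univ M))"
    if M: "definable_structure L R heyting_lang k M" "infinite (univ M)" "models M heyting_theory"
    for k and M :: "(heyting_fun, heyting_rel, 'a list) fo_struct"
  proof -
    have str: "is_structure heyting_lang M" and U: "definable L R k (univ M)"
      using M(1) by (auto simp: definable_structure_def)
    have "definable L R (2 * k) {concat xs |xs. xs \<in> tuples 2 (univ M) \<and> rel_int M HLe xs}"
      using M(1) by (simp add: definable_structure_def heyting_lang_def)
    moreover have "{concat xs |xs. xs \<in> tuples 2 (univ M) \<and> rel_int M HLe xs}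
        = {x @ y |x y. x \<in> univ M \<and> y \<in> univ M \<and> rel_int M HLe [x, y]}"
    proof (intro equalityI subsetI)
      fix w assume "w \<in> {concat xs |xs. xs \<in> tuples 2 (univ M) \<and> rel_int M HLe xs}"
      then obtain xs where xs: "w = concat xs" "xs \<in> tuples 2 (univ M)" "rel_int M HLe xs" by blast
      from xs(2) obtain x y where "xs = [x, y]" "x \<in> univ M" "y \<in> univ M"
        unfolding tuples_2 by auto
      then show "w \<in> {x @ y |x y. x \<in> univ M \<and> y \<in> univ M \<and> rel_int M HLe [x, y]}"
        using xs by auto
    next
      fix w assume "w \<in> {x @ y |x y. x \<in> univ M \<and> y \<in> univ M \<and> rel_int M HLe [x, y]}"
      then obtain x y where "w = x @ y" "x \<in> univ M" "y \<in> univ M" "rel_int M HLe [x, y]" by blast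
      then show "w \<in> {concat xs |xs. xs \<in> tuples 2 (univ M) \<and> rel_int M HLe xs}"
        by (intro CollectI exI[of _ "[x, y]"]) (simp add: tuples_def)
    qed
    ultimately have le: "definable L R (2 * k) {x @ y |x y. x \<in> univ M \<and> y \<in> univ M \<and> rel_int M HLe [x, y]}"
      by simp
    have eq: "concat ` tuples 1 (univ M) = univ M" unfolding tuples_1 image_image by simp
    have "concat ` solutions M 1 \<phi> \<subseteq> {x \<in> univ M.
        fun_int M HImp [fun_int M HImp [x, fun_int M HBot []], fun_int M HBot []] = x}"
    proof
      fix w assume "w \<in> concat ` solutions M 1 \<phi>"
      then obtain x where "x \<in> univ M" "w = x" "sat M (\<lambda>i. [x] ! i) \<phi>"
        unfolding solutions_def tuples_1 by auto
      then show "w \<in> {x \<in> univ M.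
          fun_int M HImp [fun_int M HImp [x, fun_int M HBot []], fun_int M HBot []] = x}"
        using sat[OF str M(3), of "\<lambda>i. [x] ! i"] by simp
    qed
    from solutions_dim[OF pseudocomplemented_models(1)[OF str M(3)] U M(2) le this]
    show ?thesis unfolding eq by simp
  qed
  moreover have "\<forall>\<psi>\<in>heyting_theory. formula_in heyting_lang 0 \<psi>"
    by (simp add: heyting_theory_def formula_in_def heyting_lang_def Let_def) auto
  ultimately show ?thesis
    unfolding dimensional_gap_def using \<phi> by blast
qed

theorem proposition4p21:
  fixes L :: "('f, 'p) fo_lang"
    and R :: "('f, 'p, 'a::real_closed_field) fo_struct"
  assumes "o_minimal_field L R"
  shows "dimensional_gap L R heyting_lang heyting_theory 1 excluded_middle_eq
    \<and> dimensional_gap L R heyting_lang heyting_theory 1 double_negation_eq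
    \<and> (\<forall>k H. definable_heyting_algebra L R k H \<and> infinite (carrier H) \<longrightarrow>
         (o_dim L R k {x \<in> carrier H. x \<squnion>\<^bsub>H\<^esub> hneg H x = \<top>\<^bsub>H\<^esub>} < o_dim L R k (carrier H)
            \<or> {x \<in> carrier H. x \<squnion>\<^bsub>H\<^esub> hneg H x = \<top>\<^bsub>H\<^esub>} = carrier H)
       \<and> (o_dim L R k {x \<in> carrier H. hneg H (hneg H x) = x} < o_dim L R k (carrier H)
            \<or> {x \<in> carrier H. hneg H (hneg H x) = x} = carrier H))"
proof (intro conjI allI impI)
  show "dimensional_gap L R heyting_lang heyting_theory 1 excluded_middle_eq"
    using pseudocomplemented_models(2)
    by (intro dimensional_gap_heyting assms)
      (simp_all add: excluded_middle_eq_def formula_in_def heyting_lang_def)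
  show "dimensional_gap L R heyting_lang heyting_theory 1 double_negation_eq"
    by (intro dimensional_gap_heyting assms)
      (simp_all add: double_negation_eq_def formula_in_def heyting_lang_def)
next
  fix k and H :: "'a list gorder"
  assume "definable_heyting_algebra L R k H \<and> infinite (carrier H)"
  then have H: "heyting_algebra H" "definable L R k (carrier H)" "infinite (carrier H)"
    and le: "definable L R (2 * k) {x @ y |x y. x \<in> carrier H \<and> y \<in> carrier H \<and> x \<sqsubseteq>\<^bsub>H\<^esub> y}"
    by (simp_all add: definable_heyting_algebra_def)
  note dim = o_minimal_field.solutions_dim[OF assms pseudocomplemented_order(1)[OF H(1)] H(2,3) le]
  show "o_dim L R k {x \<in> carrier H. x \<squnion>\<^bsub>H\<^esub> hneg H x = \<top>\<^bsub>H\<^esub>} < o_dim L R k (carrier H)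
      \<or> {x \<in> carrier H. x \<squnion>\<^bsub>H\<^esub> hneg H x = \<top>\<^bsub>H\<^esub>} = carrier H"
    using pseudocomplemented_order(2)[OF H(1)] by (intro disjI1 dim) blast
  show "o_dim L R k {x \<in> carrier H. hneg H (hneg H x) = x} < o_dim L R k (carrier H)
      \<or> {x \<in> carrier H. hneg H (hneg H x) = x} = carrier H"
    by (intro disjI1 dim) blast
qed

end
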